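(* (1) Every tree-automatic well-founded upwards linear partial order has rank strictly below $\omega^{\omega^\omega}$. (2) Every tree-automatic well-founded forest has rank strictly below $\omega^\omega$.
   Context: A partial order $(P,\leq)$ is upwards linear if for every $p\in P$ the set $\uparrow p=\{a\in P\mid p<a\}$ is linearly ordered by $\leq$. It is well-founded if it has no infinite strictly descending chain. A forest is an upwards linear partial order in which, for every $p$, the set $\uparrow p$ is a finite linear order. The rank of an element of a well-founded partial order is defined by $\mathsf{rank}(p)=\sup\{\mathsf{rank}(p')+1\mid p'<p\}$ (with $\sup\emptyset=0$), and the rank of the order is $\sup\{\mathsf{rank}(p)+1\mid p\in P\}$. Tree-automatic structures: a finite $\Sigma$-labeled binary tree is a pair $(T,\lambda)$ with $T$ a nonempty finite prefix-closed subset of $\{0,1\}^*$ and $\lambda:T\to\Sigma$. The convolution of trees $t_1,\dots,t_n$ (with $t_i=(T_i,\lambda_i)$) is the tree with domain $\bigcup_i T_i$ labeled at $u$ by the tuple whose $i$-th entry is $\lambda_i(u)$ if $u\in T_i$ and a padding symbol $\diamond$ otherwise. A set of such trees is regular if it is accepted by a (finite) tree automaton. A relational structure is tree-automatic if its domain is a regular set of finite $\Sigma$-labeled binary trees (for some finite $\Sigma$) and for each of its relations the set of convolutions of the tuples in the relation is regular; a structure isomorphic to such a structure is also called tree-automatic. A partial order is regarded as a structure with the single binary relation $\leq$. *)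

theory Defs
  imports Main "HOL-Library.Countable_Set"
begin

section \<open>Countable ordinals\<close>

text \<open>
  A well-ordered type of order type \<open>\<omega>\<^sub>1\<close>: its elements are exactly the countable ordinals,
  an element standing for the order type of the set of its predecessors. Every tree-automatic
  structure is countable (\<open>tree_automatic_countable\<close> below), so the ranks of its elements and of
  the whole order are countable ordinals.
\<close>

typedef cord = "Field (cardSuc natLeq)"
proof -
  have "Field (cardSuc natLeq) \<noteq> {}"
    using cardSuc_finite[OF natLeq_Card_order] by (auto simp: Field_natLeq)
  then show ?thesis by blast
qed

instantiation cord :: linorder
begin

definition less_eq_cord :: "cord \<Rightarrow> cord \<Rightarrow> bool"
  where "x \<le> y \<longleftrightarrow> (Rep_cord x, Rep_cord y) \<in> cardSuc natLeq"

definition less_cord :: "cord \<Rightarrow> cord \<Rightarrow> bool"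
  where "(x::cord) < y \<longleftrightarrow> x \<le> y \<and> x \<noteq> y"

instance
proof
  have W: "Well_order (cardSuc natLeq)"
    using cardSuc_Card_order[OF natLeq_Card_order] card_order_on_well_order_on by blast
  then have refl: "refl_on (Field (cardSuc natLeq)) (cardSuc natLeq)"
    and trans: "trans (cardSuc natLeq)" and antisym: "antisym (cardSuc natLeq)"
    and total: "total_on (Field (cardSuc natLeq)) (cardSuc natLeq)"
    by (auto simp: order_on_defs well_order_on_def)
  fix x y z :: cord
  show "x \<le> x" using refl Rep_cord[of x] by (auto simp: less_eq_cord_def refl_on_def)
  show "x \<le> y \<Longrightarrow> y \<le> z \<Longrightarrow> x \<le> z" using trans unfolding less_eq_cord_def by (rule transD)
  show anti: "x \<le> y \<Longrightarrow> y \<le> x \<Longrightarrow> x = y"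
    using antisym unfolding less_eq_cord_def Rep_cord_inject[symmetric] by (rule antisymD)
  show "(x < y) = (x \<le> y \<and> \<not> y \<le> x)"
    using \<open>x \<le> x\<close> anti by (auto simp: less_cord_def)
  show "x \<le> y \<or> y \<le> x"
    using total \<open>x \<le> x\<close> Rep_cord[of x] Rep_cord[of y]
    by (cases "x = y") (auto simp: less_eq_cord_def total_on_def Rep_cord_inject)
qed

end

lemma wf_less_cord: "wf {(x::cord, y). x < y}"
proof -
  have "Well_order (cardSuc natLeq)"
    using cardSuc_Card_order[OF natLeq_Card_order] card_order_on_well_order_on by blast
  then have "wf (inv_image (cardSuc natLeq - Id) Rep_cord)"
    by (intro wf_inv_image) (simp add: well_order_on_def)
  moreover have "{(x::cord, y). x < y} \<subseteq> inv_image (cardSuc natLeq - Id) Rep_cord"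
    by (auto simp: less_cord_def less_eq_cord_def Rep_cord_inject)
  ultimately show ?thesis by (rule wf_subset)
qed

instance cord :: wellorder
proof
  fix P :: "cord \<Rightarrow> bool" and a
  assume step: "\<And>x. (\<And>y. y < x \<Longrightarrow> P y) \<Longrightarrow> P x"
  show "P a" using wf_less_cord by (rule wf_induct_rule) (auto intro: step)
qed

lemma countable_lessThan_cord:
  includes cardinal_syntax
  shows "countable {..<a::cord}"
proof -
  let ?r = "cardSuc natLeq"
  have C: "Card_order ?r" by (rule cardSuc_Card_order[OF natLeq_Card_order])
  have "Rep_cord ` {..<a} \<subseteq> underS ?r (Rep_cord a)"
    by (auto simp: underS_def less_cord_def less_eq_cord_def Rep_cord_inject)
  moreover have "countable (underS ?r (Rep_cord a))"
  proof -
    have "|underS ?r (Rep_cord a)| <o ?r" using C Rep_cord by (rule card_of_underS)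
    then have "|underS ?r (Rep_cord a)| \<le>o natLeq"
      using cardSuc_ordLeq_ordLess[OF natLeq_Card_order card_of_Card_order] by blast
    then have "|underS ?r (Rep_cord a)| \<le>o |UNIV :: nat set|"
      using card_of_nat ordIso_symmetric ordLeq_ordIso_trans by blast
    then obtain f :: "_ \<Rightarrow> nat" where "inj_on f (underS ?r (Rep_cord a))"
      using card_of_ordLeq[of "underS ?r (Rep_cord a)" "UNIV :: nat set"] by blast
    then show ?thesis by (rule countableI)
  qed
  ultimately have "countable (Rep_cord ` {..<a})" by (rule countable_subset)
  then show ?thesis
    by (rule countable_image_inj_on) (auto simp: inj_on_def Rep_cord_inject)
qed

lemma uncountable_UNIV_cord:
  includes cardinal_syntax
  shows "uncountable (UNIV :: cord set)"
proof
  let ?r = "cardSuc natLeq"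
  assume "countable (UNIV :: cord set)"
  then have "countable (range Rep_cord)" by simp
  moreover have "range Rep_cord = Field ?r" using type_definition_cord
    by (rule type_definition.Rep_range)
  ultimately obtain f :: "_ \<Rightarrow> nat" where "inj_on f (Field ?r)" by (auto simp: countable_def)
  then have "|Field ?r| \<le>o |UNIV :: nat set|" using card_of_ordLeq by blast
  then have "?r \<le>o natLeq"
    by (rule ordIso_ordLeq_trans[OF ordIso_symmetric[OF
          card_of_Field_ordIso[OF cardSuc_Card_order[OF natLeq_Card_order]]]
          ordLeq_ordIso_trans[OF _ card_of_nat]])
  then show False
    using cardSuc_greater[OF natLeq_Card_order] not_ordLess_ordLeq by blast
qed

lemma countable_bounded_cord:
  assumes "countable (S :: cord set)"
  shows "\<exists>b. \<forall>x\<in>S. x < b"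
proof (rule ccontr)
  assume "\<not> ?thesis"
  then have "\<forall>b. \<exists>x\<in>S. b \<le> x" by (meson not_le)
  then have "UNIV = (\<Union>x\<in>S. insert x {..<x})" by (auto simp: le_less)
  moreover have "countable (\<Union>x\<in>S. insert x {..<x})"
    using assms countable_lessThan_cord by auto
  ultimately show False using uncountable_UNIV_cord by simp
qed

definition ozero :: cord
  where "ozero = (LEAST x. True)"

definition osucc :: "cord \<Rightarrow> cord"
  where "osucc a = (LEAST x. a < x)"

definition osup :: "cord set \<Rightarrow> cord"
  where "osup S = (LEAST b. \<forall>x\<in>S. x \<le> b)"

text \<open>Suprema exist for countable sets; \<open>osup\<close> of an uncountable set is unspecified.\<close>

lemma ozero_le: "ozero \<le> a"
  unfolding ozero_def by (rule Least_le) simp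

lemma osup_empty: "osup {} = ozero"
  by (simp add: osup_def ozero_def)

lemma osucc_le_iff: "osucc a \<le> b \<longleftrightarrow> a < b"
proof -
  obtain c where "a < c" using countable_bounded_cord[of "{a}"] by auto
  then have "a < osucc a" unfolding osucc_def by (rule LeastI)
  moreover have "osucc a \<le> b" if "a < b"
    unfolding osucc_def using that by (rule Least_le)
  ultimately show ?thesis by (blast intro: less_le_trans)
qed

lemma less_osucc: "a < osucc a"
  by (simp flip: osucc_le_iff)

lemma osup_le_iff:
  assumes "countable S"
  shows "osup S \<le> b \<longleftrightarrow> (\<forall>x\<in>S. x \<le> b)"
proof -
  obtain c where "\<forall>x\<in>S. x \<le> c" using countable_bounded_cord[OF assms] by (meson less_imp_le)
  then have "\<forall>x\<in>S. x \<le> osup S" unfolding osup_def by (rule LeastI)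
  moreover have "osup S \<le> b" if "\<forall>x\<in>S. x \<le> b"
    unfolding osup_def using that by (rule Least_le)
  ultimately show ?thesis by (blast intro: order_trans)
qed

lemma osucc_inject: "osucc a = osucc b \<longleftrightarrow> a = b"
proof
  assume *: "osucc a = osucc b"
  have "a = b" if "\<not> a < b" "\<not> b < a" using that by simp
  moreover have "\<not> a < b" using * less_osucc[of b] osucc_le_iff[of a b] by auto
  moreover have "\<not> b < a" using * less_osucc[of a] osucc_le_iff[of b a] by auto
  ultimately show "a = b" by blast
qed simp

text \<open>\<open>otrec z s\<close> is \<open>z\<close> at zero, applies \<open>s\<close> at successors and takes suprema at limits.\<close>

definition otrec :: "cord \<Rightarrow> (cord \<Rightarrow> cord) \<Rightarrow> cord \<Rightarrow> cord"
  where "otrec z s = wfrec {(x, y). x < y}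
    (\<lambda>f b. if b = ozero then z
      else if \<exists>c. b = osucc c then s (f (THE c. b = osucc c))
      else osup (f ` {ozero<..<b}))"

lemma otrec_unfold:
  "otrec z s b = (if b = ozero then z
      else if \<exists>c. b = osucc c then s (otrec z s (THE c. b = osucc c))
      else osup (otrec z s ` {ozero<..<b}))"
proof -
  have adm: "adm_wf {(x::cord, y). x < y} (\<lambda>f b. if b = ozero then z
      else if \<exists>c. b = osucc c then s (f (THE c. b = osucc c))
      else osup (f ` {ozero<..<b}))"
    unfolding adm_wf_def
  proof (intro allI impI)
    fix f g :: "cord \<Rightarrow> cord" and b
    assume *: "\<forall>c. (c, b) \<in> {(x, y). x < y} \<longrightarrow> f c = g c"
    have "f ` {ozero<..<b} = g ` {ozero<..<b}"
      using * by (intro image_cong) auto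
    moreover have "f (THE c. b = osucc c) = g (THE c. b = osucc c)" if "b = osucc c" for c
      using that * less_osucc by (simp add: osucc_inject)
    ultimately show "(if b = ozero then z
      else if \<exists>c. b = osucc c then s (f (THE c. b = osucc c)) else osup (f ` {ozero<..<b})) =
      (if b = ozero then z
      else if \<exists>c. b = osucc c then s (g (THE c. b = osucc c)) else osup (g ` {ozero<..<b}))"
      by (intro if_cong arg_cong[of _ _ s] arg_cong[of _ _ osup] refl) blast+
  qed
  show ?thesis
    unfolding otrec_def by (rule wfrec_fixpoint[OF wf_less_cord adm, THEN fun_cong])
qed

lemma otrec_zero: "otrec z s ozero = z"
  by (subst otrec_unfold) simp

lemma osucc_neq_zero: "osucc a \<noteq> ozero"
  using less_osucc[of a] ozero_le[of a] by auto

lemma otrec_succ: "otrec z s (osucc b) = s (otrec z s b)"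
  using otrec_unfold[of z s "osucc b"] by (simp add: osucc_neq_zero osucc_inject)

lemma otrec_limit:
  assumes "b \<noteq> ozero" "\<And>c. b \<noteq> osucc c"
  shows "otrec z s b = osup (otrec z s ` {ozero<..<b})"
  using otrec_unfold[of z s b] assms by simp

definition oadd :: "cord \<Rightarrow> cord \<Rightarrow> cord"
  where "oadd a = otrec a osucc"

definition omult :: "cord \<Rightarrow> cord \<Rightarrow> cord"
  where "omult a = otrec ozero (\<lambda>x. oadd x a)"

definition oexp :: "cord \<Rightarrow> cord \<Rightarrow> cord"
  where "oexp a = otrec (osucc ozero) (\<lambda>x. omult x a)"

definition omega :: cord
  where "omega = osup (range (\<lambda>n. (osucc ^^ n) ozero))"

section \<open>Partial orders and rank\<close>

text \<open>A partial order \<open>(P, \<le>)\<close> is given by its carrier and the set \<open>r\<close> of pairs \<open>(x, y)\<close> with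
  \<open>x \<le> y\<close>; the strict order is \<open>r - Id\<close>.\<close>

definition up :: "'a set \<Rightarrow> 'a rel \<Rightarrow> 'a \<Rightarrow> 'a set"
  where "up P r p = {a \<in> P. (p, a) \<in> r - Id}"

definition upwards_linear :: "'a set \<Rightarrow> 'a rel \<Rightarrow> bool"
  where "upwards_linear P r \<longleftrightarrow> partial_order_on P r \<and>
    (\<forall>p\<in>P. linear_order_on (up P r p) (Restr r (up P r p)))"

definition forest :: "'a set \<Rightarrow> 'a rel \<Rightarrow> bool"
  where "forest P r \<longleftrightarrow> upwards_linear P r \<and> (\<forall>p\<in>P. finite (up P r p))"

definition well_founded :: "'a rel \<Rightarrow> bool"
  where "well_founded r \<longleftrightarrow> wf (r - Id)"

definition elem_rank :: "'a rel \<Rightarrow> 'a \<Rightarrow> cord"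
  where "elem_rank r = wfrec (r - Id) (\<lambda>f p. osup {osucc (f q) | q. (q, p) \<in> r - Id})"

definition order_rank :: "'a set \<Rightarrow> 'a rel \<Rightarrow> cord"
  where "order_rank P r = osup {osucc (elem_rank r p) | p. p \<in> P}"

lemma well_founded_iff_no_descending_chain:
  "well_founded r \<longleftrightarrow> \<not> (\<exists>f :: nat \<Rightarrow> 'a. \<forall>i. (f (Suc i), f i) \<in> r - Id)"
  unfolding well_founded_def by (rule wf_iff_no_infinite_down_chain)

lemma elem_rank_unfold:
  assumes "well_founded r"
  shows "elem_rank (r :: 'a rel) p = osup {osucc (elem_rank r q) | q. (q, p) \<in> r - Id}"
proof -
  have "adm_wf (r - Id) (\<lambda>f p. osup {osucc (f q) | q. (q, p) \<in> r - Id})"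
    unfolding adm_wf_def
  proof (intro allI impI arg_cong[of _ _ osup])
    fix f g :: "'a \<Rightarrow> cord" and p
    assume "\<forall>q. (q, p) \<in> r - Id \<longrightarrow> f q = g q"
    then have "(\<lambda>q. osucc (f q)) ` {q. (q, p) \<in> r - Id} = (\<lambda>q. osucc (g q)) ` {q. (q, p) \<in> r - Id}"
      by (intro image_cong) auto
    then show "{osucc (f q) | q. (q, p) \<in> r - Id} = {osucc (g q) | q. (q, p) \<in> r - Id}"
      by (simp only: setcompr_eq_image)
  qed
  with assms show ?thesis
    unfolding elem_rank_def well_founded_def
    by (intro wfrec_fixpoint[THEN fun_cong])
qed

section \<open>Trees, tree automata and tree-automatic structures\<close>

text \<open>A labeled binary tree \<open>(T, \<lambda>)\<close> is encoded as the partial map with domain \<open>T\<close> and values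
  \<open>\<lambda>\<close>; \<open>False\<close> and \<open>True\<close> play the roles of the directions 0 and 1.\<close>

type_synonym 's btree = "bool list \<Rightarrow> 's option"

definition labeled_tree :: "'s set \<Rightarrow> 's btree \<Rightarrow> bool"
  where "labeled_tree \<Sigma> t \<longleftrightarrow> finite (dom t) \<and> dom t \<noteq> {} \<and>
    (\<forall>u v. u @ v \<in> dom t \<longrightarrow> u \<in> dom t) \<and> ran t \<subseteq> \<Sigma>"

text \<open>Labels of the convolution are lists over \<open>'s option\<close>, with \<open>None\<close> as the padding symbol.\<close>

definition convolution :: "'s btree list \<Rightarrow> 's option list btree"
  where "convolution ts u =
    (if u \<in> (\<Union>t\<in>set ts. dom t) then Some (map (\<lambda>t. t u) ts) else None)"

text \<open>Nondeterministic bottom-up tree automata. A transition \<open>(p, q, a, s)\<close> assigns the state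
  \<open>s\<close> to an \<open>a\<close>-labeled node whose children carry the states \<open>p\<close> and \<open>q\<close>, where \<open>None\<close> means
  that the respective child does not exist.\<close>

record 's tree_automaton =
  states :: "nat set"
  alphabet :: "'s set"
  transitions :: "(nat option \<times> nat option \<times> 's \<times> nat) set"
  accepting :: "nat set"

definition tree_automaton :: "'s tree_automaton \<Rightarrow> bool"
  where "tree_automaton A \<longleftrightarrow> finite (states A) \<and> finite (alphabet A) \<and>
    transitions A \<subseteq> insert None (Some ` states A) \<times> insert None (Some ` states A) \<times>
      alphabet A \<times> states A \<and>
    accepting A \<subseteq> states A"

definition is_run :: "'s tree_automaton \<Rightarrow> 's btree \<Rightarrow> (bool list \<Rightarrow> nat) \<Rightarrow> bool"
  where "is_run A t \<rho> \<longleftrightarrow>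
    (let st = (\<lambda>u. if u \<in> dom t then Some (\<rho> u) else None) in
      \<forall>u a. t u = Some a \<longrightarrow>
        (st (u @ [False]), st (u @ [True]), a, \<rho> u) \<in> transitions A)"

definition language :: "'s tree_automaton \<Rightarrow> 's btree set"
  where "language A = {t. labeled_tree (alphabet A) t \<and> (\<exists>\<rho>. is_run A t \<rho> \<and> \<rho> [] \<in> accepting A)}"

definition regular :: "'s btree set \<Rightarrow> bool"
  where "regular L \<longleftrightarrow> (\<exists>A. tree_automaton A \<and> L = language A)"

text \<open>A relational structure is a carrier with a list of relations, a relation of arity \<open>n > 0\<close>
  being a set of lists of length \<open>n\<close>.\<close>

definition rel_structure :: "'a set \<Rightarrow> 'a list set list \<Rightarrow> bool"
  where "rel_structure A Rs \<longleftrightarrow>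
    (\<forall>R\<in>set Rs. \<exists>n>0. \<forall>xs\<in>R. length xs = n \<and> set xs \<subseteq> A)"

definition structure_iso ::
  "('a \<Rightarrow> 'b) \<Rightarrow> 'a set \<Rightarrow> 'a list set list \<Rightarrow> 'b set \<Rightarrow> 'b list set list \<Rightarrow> bool"
  where "structure_iso f A Rs B Ss \<longleftrightarrow>
    bij_betw f A B \<and> Ss = map (\<lambda>R. map f ` R) Rs"

definition tree_presentation :: "'s set \<Rightarrow> 's btree set \<Rightarrow> 's btree list set list \<Rightarrow> bool"
  where "tree_presentation \<Sigma> D Rs \<longleftrightarrow> finite \<Sigma> \<and> (\<forall>t\<in>D. labeled_tree \<Sigma> t) \<and> regular D \<and>
    rel_structure D Rs \<and> (\<forall>R\<in>set Rs. regular (convolution ` R))"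

text \<open>Every finite alphabet can be renamed to a finite set of natural numbers.\<close>

definition tree_automatic :: "'a set \<Rightarrow> 'a list set list \<Rightarrow> bool"
  where "tree_automatic A Rs \<longleftrightarrow>
    (\<exists>(\<Sigma> :: nat set) D Ss f. tree_presentation \<Sigma> D Ss \<and> structure_iso f D Ss A Rs)"

definition tree_automatic_order :: "'a set \<Rightarrow> 'a rel \<Rightarrow> bool"
  where "tree_automatic_order P r \<longleftrightarrow> tree_automatic P [{[x, y] | x y. (x, y) \<in> r}]"

lemma countable_labeled_trees: "countable {t :: nat btree. labeled_tree \<Sigma> t}"
proof (rule countable_image_inj_on)
  have "Map.graph ` {t :: nat btree. labeled_tree \<Sigma> t} \<subseteq> {X. finite X}"
    by (auto simp: labeled_tree_def)
  moreover have "countable {X :: (bool list \<times> nat) set. finite X}"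
    by (rule countable_Collect_finite)
  ultimately show "countable (Map.graph ` {t :: nat btree. labeled_tree \<Sigma> t})"
    by (rule countable_subset)
  show "inj_on Map.graph {t :: nat btree. labeled_tree \<Sigma> t}"
  proof (rule inj_onI, rule ext)
    fix s t :: "nat btree" and u
    assume *: "Map.graph s = Map.graph t"
    have iff: "s u = Some v \<longleftrightarrow> t u = Some v" for v
    proof -
      have "(u, v) \<in> Map.graph s \<longleftrightarrow> (u, v) \<in> Map.graph t" by (simp only: *)
      then show ?thesis by (simp add: Map.graph_def)
    qed
    show "s u = t u"
    proof (cases "s u")
      case None
      then have "t u \<noteq> Some v" for v using iff[of v] by simp
      then have "t u = None" by (meson not_None_eq)
      with None show ?thesis by simp
    next
      case (Some v)
      then show ?thesis using iff[of v] by simp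
    qed
  qed
qed

lemma tree_automatic_countable:
  assumes "tree_automatic A Rs"
  shows "countable A"
proof -
  obtain \<Sigma> :: "nat set" and D f where "\<forall>t\<in>D. labeled_tree \<Sigma> t" "bij_betw f D A"
    using assms by (auto simp: tree_automatic_def tree_presentation_def structure_iso_def)
  moreover from this have "countable D"
    by (intro countable_subset[OF _ countable_labeled_trees[of \<Sigma>]]) auto
  ultimately show ?thesis
    by (metis bij_betw_imp_surj_on countable_image)
qed

end

theory Submission
  imports Defs "HOL-Library.Multiset_Order" "HOL-Library.FuncSet" "HOL-Library.Disjoint_Sets"
begin

text \<open>
  Fix an element \<open>p\<close>. The elements below \<open>p\<close> fall into finitely many classes, according to their
  restriction to the domain of \<open>p\<close> and the types (sets of reachable states) of the subtrees hanging
  off this domain. Such a class is a product over the boundary nodes, and the order between two of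
  its elements only depends on the types of the pairs of corresponding subtrees (Delhomme's box
  decomposition). The order on a single coordinate is one of finitely many relations, which do not
  depend on \<open>p\<close>; if such a relation has a rank below the bound in question, it is below a bound
  fixed in advance.

  In a long chain of a box, two elements \<open>h < h'\<close> have the same type over the least element, so upwards
  linearity compares \<open>h\<close> with all mixtures of \<open>h\<close> and \<open>h'\<close>, and some coordinate of \<open>h\<close> is strictly
  below that of \<open>h'\<close>. Therefore the rank of a box is at most a finite multiple of the natural product
  of the ranks of the coordinates, which stays below \<open>\<omega>\<close> to the \<open>\<omega>\<^sup>k\<close> for a fixed \<open>k\<close>. In a forest, of two
  disjoint groups of coordinates at most one has elements with infinitely many predecessors, so
  the coordinates can be arranged in three groups and the product stays below \<open>\<omega>\<^sup>k\<close>. In both cases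
  the ranks of the elements leave a gap which they cannot cross.
\<close>

section \<open>Ranks measured by multisets\<close>

text \<open>
  Ordinals are represented by elements of wellorders. If \<open>'e\<close> has order type \<open>\<alpha>\<close>, then
  \<open>'e multiset\<close> has order type \<open>\<omega>\<^sup>\<alpha>\<close>: the multiset \<open>{#e\<^sub>1, \<dots>, e\<^sub>n#}\<close> with \<open>e\<^sub>1 \<ge> \<dots> \<ge> e\<^sub>n\<close> stands
  for the Cantor normal form with these exponents, and \<open>+\<close> is the natural sum.
\<close>

definition rank_below :: "'x rel \<Rightarrow> 'x set \<Rightarrow> 'w::wellorder \<Rightarrow> bool"
  where "rank_below R A w \<longleftrightarrow>
    (\<exists>f. (\<forall>x\<in>A. f x < w) \<and> (\<forall>x\<in>A. \<forall>y\<in>A. (x, y) \<in> R \<longrightarrow> f x < f y))"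

lemma rank_below_map:
  assumes "rank_below R A w" "w \<le> w'" "g ` B \<subseteq> A"
    and "\<And>x y. x \<in> B \<Longrightarrow> y \<in> B \<Longrightarrow> (x, y) \<in> S \<Longrightarrow> (g x, g y) \<in> R"
  shows "rank_below S B w'"
proof -
  obtain f where "\<forall>x\<in>A. f x < w" "\<forall>x\<in>A. \<forall>y\<in>A. (x, y) \<in> R \<longrightarrow> f x < f y"
    using assms(1) unfolding rank_below_def by blast
  then have "\<forall>x\<in>B. f (g x) < w'" "\<forall>x\<in>B. \<forall>y\<in>B. (x, y) \<in> S \<longrightarrow> f (g x) < f (g y)"
    using assms(2,3) by (simp_all add: assms(4) image_subset_iff) (meson less_le_trans)
  then show ?thesis unfolding rank_below_def by (intro exI[of _ "\<lambda>x. f (g x)"]) simp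
qed

lemma rank_below_mono:
  assumes "rank_below R A w" "B \<subseteq> A" "w \<le> w'"
  shows "rank_below R B w'"
  using rank_below_map[OF assms(1,3), of "\<lambda>x. x" B R] assms(2) by auto

lemma rank_below_empty: "rank_below R {} w"
  by (simp add: rank_below_def)

text \<open>Send \<open>y\<close> to the least bound of its strict lower set. If \<open>x\<close>
  lies below \<open>y\<close>, a map witnessing the bound at \<open>y\<close> also bounds the lower
  set of \<open>x\<close> by its value at \<open>x\<close>, which is smaller.\<close>

lemma rank_below_step:
  fixes w :: "'w::wellorder"
  assumes "trans R" and below: "\<And>y. y \<in> A \<Longrightarrow> \<exists>w'<w. rank_below R {z \<in> A. (z, y) \<in> R} w'"
  shows "rank_below R A w"
proof -
  define f :: "_ \<Rightarrow> 'w" where "f y = (LEAST w'. rank_below R {z \<in> A. (z, y) \<in> R} w')" for y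
  have "f y < w" if "y \<in> A" for y
    using below[OF that] unfolding f_def by (meson Least_le le_less_trans)
  moreover have "f x < f y" if "x \<in> A" "y \<in> A" "(x, y) \<in> R" for x y
  proof -
    let ?A = "{z \<in> A. (z, y) \<in> R}"
    have "rank_below R ?A (f y)"
      unfolding f_def using below[OF \<open>y \<in> A\<close>] by (blast intro: LeastI)
    then obtain g where g: "\<forall>z\<in>?A. g z < f y" "\<forall>z\<in>?A. \<forall>u\<in>?A. (z, u) \<in> R \<longrightarrow> g z < g u"
      unfolding rank_below_def by blast
    have "{z \<in> A. (z, x) \<in> R} \<subseteq> ?A"
      using \<open>trans R\<close> that by (auto dest: transD)
    then have "rank_below R {z \<in> A. (z, x) \<in> R} (g x)"
      using g(2) that unfolding rank_below_def by blast
    then have "f x \<le> g x" unfolding f_def by (rule Least_le)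
    also have "g x < f y" using g(1) that by blast
    finally show ?thesis .
  qed
  ultimately show ?thesis unfolding rank_below_def by blast
qed

text \<open>Here \<open>a x\<close> is the strict supremum of the values of \<open>f\<close> at the
  elements of \<open>A\<close> below \<open>x\<close>. This extends the rank from \<open>A\<close>
  to all elements: weakly increasing everywhere, strictly increasing on leaving an element of
  \<open>A\<close>.\<close>

lemma rank_below_relative:
  assumes "trans R" "rank_below R A w"
  shows "\<exists>a. (\<forall>x. a x \<le> w) \<and> (\<forall>x\<in>A. a x < w) \<and> (\<forall>x y. (x, y) \<in> R \<longrightarrow> a x \<le> a y) \<and>
    (\<forall>x\<in>A. \<forall>y. (x, y) \<in> R \<longrightarrow> a x < a y)"
proof -
  obtain f where f: "\<forall>x\<in>A. f x < w" "\<forall>x\<in>A. \<forall>y\<in>A. (x, y) \<in> R \<longrightarrow> f x < f y"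
    using assms(2) unfolding rank_below_def by blast
  define a where "a x = (LEAST b. \<forall>y\<in>A. (y, x) \<in> R \<longrightarrow> f y < b)" for x
  have a: "\<forall>y\<in>A. (y, x) \<in> R \<longrightarrow> f y < a x" for x
    unfolding a_def by (rule LeastI[of _ w]) (use f in blast)
  have le: "a x \<le> b" if "\<forall>y\<in>A. (y, x) \<in> R \<longrightarrow> f y < b" for x b
    unfolding a_def using that by (rule Least_le)
  have "a x \<le> w" for x using f(1) by (intro le) blast
  moreover have af: "a x \<le> f x" if "x \<in> A" for x using f(2) that by (intro le) blast
  moreover have "a x < w" if "x \<in> A" for x using af[OF that] f(1) that by (meson le_less_trans)
  moreover have "a x \<le> a y" if "(x, y) \<in> R" for x y
    using a[of y] that \<open>trans R\<close> by (intro le) (meson transD)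
  moreover have "a x < a y" if "x \<in> A" "(x, y) \<in> R" for x y
    using af[OF \<open>x \<in> A\<close>] a[of y] that by (meson le_less_trans)
  ultimately show ?thesis by blast
qed

text \<open>Add the relative ranks over \<open>A\<close> and over \<open>B\<close>. Above an element
  of the union at least one summand rises strictly and the other does not fall.\<close>

lemma rank_below_Un:
  fixes w w' :: "'w::{wellorder,ordered_cancel_comm_monoid_add}"
  assumes "trans R" "rank_below R A w" "rank_below R B w'"
  shows "rank_below R (A \<union> B) (w + w')"
proof -
  obtain a where a: "\<And>x. a x \<le> w" "\<And>x. x \<in> A \<Longrightarrow> a x < w" "\<And>x y. (x, y) \<in> R \<Longrightarrow> a x \<le> a y"
    "\<And>x y. x \<in> A \<Longrightarrow> (x, y) \<in> R \<Longrightarrow> a x < a y"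
    using rank_below_relative[OF assms(1,2)] by blast
  obtain b where b: "\<And>x. b x \<le> w'" "\<And>x. x \<in> B \<Longrightarrow> b x < w'" "\<And>x y. (x, y) \<in> R \<Longrightarrow> b x \<le> b y"
    "\<And>x y. x \<in> B \<Longrightarrow> (x, y) \<in> R \<Longrightarrow> b x < b y"
    using rank_below_relative[OF assms(1,3)] by blast
  have "a x + b x < w + w'" if "x \<in> A \<union> B" for x
    using that a b by (auto intro: add_less_le_mono add_le_less_mono)
  moreover have "a x + b x < a y + b y" if "x \<in> A \<union> B" "(x, y) \<in> R" for x y
    using that a b by (auto intro: add_less_le_mono add_le_less_mono)
  ultimately show ?thesis unfolding rank_below_def by (intro exI[of _ "\<lambda>x. a x + b x"]) blast
qed

lemma rank_below_UN:
  fixes w :: "'i \<Rightarrow> 'w::{wellorder,ordered_cancel_comm_monoid_add}"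
  assumes "trans R" "finite I" "\<And>i. i \<in> I \<Longrightarrow> rank_below R (A i) (w i)"
  shows "rank_below R (\<Union>i\<in>I. A i) (sum w I)"
  using assms(2,3) by (induction rule: finite_induct) (simp_all add: rank_below_empty rank_below_Un assms(1))

section \<open>Intervals between Cantor normal forms\<close>

text \<open>The two bounds differ by one copy of \<open>e\<close>, which is at most every exponent
  of \<open>w\<close>. So \<open>v\<close> must agree with \<open>w\<close> from \<open>e\<close>
  upwards and can only add smaller entries.\<close>

lemma multiset_interval:
  fixes v w :: "'e::linorder multiset"
  assumes "w \<le> v" "v < add_mset e w" "\<And>x. x \<in># w \<Longrightarrow> e \<le> x"
  shows "\<exists>u<{#e#}. v = w + u"
proof -
  have "count v y = count w y" if "e \<le> y" for y
  proof (rule ccontr)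
    assume neq: "count v y \<noteq> count w y"
    define S where "S = {y. e \<le> y \<and> count v y \<noteq> count w y}"
    have "S \<subseteq> set_mset v \<union> set_mset w"
      by (auto simp: S_def not_in_iff)
    then have fin: "finite S" by (rule finite_subset) simp
    \<comment> \<open>The largest position from \<open>e\<close> upwards at which the counts differ.
      It decides both comparisons: the lower bound makes \<open>v\<close> exceed \<open>w\<close>
      there, the upper bound then forces \<open>m = e\<close>.\<close>
    define m where "m = Max S"
    have "m \<in> S" unfolding m_def using fin neq that by (intro Max_in) (auto simp: S_def)
    have above: "count v x = count w x" if "m < x" for x
    proof (rule ccontr)
      assume "count v x \<noteq> count w x"
      with that \<open>m \<in> S\<close> have "x \<in> S" by (auto simp: S_def)
      with that fin show False unfolding m_def by (meson Max_ge not_le)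
    qed
    have "\<not> count v m < count w m"
    proof
      assume less: "count v m < count w m"
      have "\<exists>x>y. count v x < count w x" if "count w y < count v y" for y
      proof (rule exI[of _ m], intro conjI less)
        have "y \<noteq> m" "\<not> m < y" using that less above[of y] by auto
        then show "y < m" by simp
      qed
      then have "v < w" unfolding less_multiset\<^sub>H\<^sub>O using less by auto
      with assms(1) show False by simp
    qed
    with \<open>m \<in> S\<close> have gt: "count w m < count v m" and "e \<le> m" by (auto simp: S_def)
    have "count (add_mset e w) m = count v m"
    proof (rule antisym)
      show "count (add_mset e w) m \<le> count v m" using gt by simp
      show "count v m \<le> count (add_mset e w) m"
      proof (rule ccontr)
        assume "\<not> ?thesis"
        then obtain x where "m < x" "count v x < count (add_mset e w) x"
          using assms(2) unfolding less_multiset\<^sub>H\<^sub>O by (auto simp: not_le)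
        with above[of x] \<open>e \<le> m\<close> show False by (auto split: if_splits)
      qed
    qed
    with gt have "m = e" by (auto split: if_splits)
    have "add_mset e w \<subseteq># v"
    proof (rule mset_subset_eqI)
      fix y
      consider "y < e" | "y = e" | "e < y" by fastforce
      then show "count (add_mset e w) y \<le> count v y"
      proof cases
        case 1
        then have "y \<notin># w" using assms(3)[of y] by auto
        with 1 show ?thesis by (auto simp: not_in_iff)
      next
        case 2
        then show ?thesis using \<open>count (add_mset e w) m = count v m\<close> \<open>m = e\<close> by simp
      next
        case 3
        then show ?thesis using above[of y] \<open>m = e\<close> by simp
      qed
    qed
    then have "add_mset e w \<le> v" by (rule subset_eq_imp_le_multiset)
    with assms(2) show False by simp
  qed note eq = this
  have "w \<subseteq># v"
  proof (rule mset_subset_eqI)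
    fix y show "count w y \<le> count v y"
    proof (cases "e \<le> y")
      case False
      then have "y \<notin># w" using assms(3)[of y] by auto
      then show ?thesis by (simp add: not_in_iff)
    qed (simp add: eq)
  qed
  then obtain u where u: "v = w + u" by (auto simp: mset_subset_eq_exists_conv)
  moreover have "x < e" if "x \<in># u" for x
  proof (rule ccontr)
    assume "\<not> x < e"
    then have "count (w + u) x = count w x" using eq[of x] u by simp
    with that show False by (simp add: not_in_iff[symmetric])
  qed
  ultimately show ?thesis by auto
qed

text \<open>An ordinal splits into blocks of the lengths given by its Cantor normal form.\<close>

lemma rank_below_decompose:
  fixes w :: "'e::wellorder multiset"
    and g :: "'e \<Rightarrow> 'w::{wellorder,ordered_cancel_comm_monoid_add}"
  assumes "trans R" "rank_below U A w"
    and "\<And>B e. B \<subseteq> A \<Longrightarrow> e \<in># w \<Longrightarrow> rank_below U B {#e#} \<Longrightarrow> rank_below R B (g e)"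
  shows "rank_below R A (\<Sum>e\<in>#w. g e)"
  using assms(2,3)
proof (induction w arbitrary: A rule: multiset_induct_min)
  case empty
  then have "A = {}" by (auto simp: rank_below_def)
  then show ?case by (simp add: rank_below_empty)
next
  case (add e w)
  obtain f where f: "\<forall>x\<in>A. f x < add_mset e w" "\<forall>x\<in>A. \<forall>y\<in>A. (x, y) \<in> U \<longrightarrow> f x < f y"
    using add.prems(1) unfolding rank_below_def by blast
  let ?B = "{x \<in> A. f x < w}" and ?C = "{x \<in> A. w \<le> f x}"
  have "rank_below U ?B w" using f(2) unfolding rank_below_def by blast
  then have B: "rank_below R ?B (\<Sum>e\<in>#w. g e)"
    using add.prems(2) by (intro add.IH) auto
  have "\<exists>u<{#e#}. f x = w + u" if "x \<in> ?C" for x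
    using that f(1) add.hyps by (intro multiset_interval) auto
  then obtain u where u: "\<And>x. x \<in> ?C \<Longrightarrow> u x < {#e#} \<and> f x = w + u x" by metis
  have "rank_below U ?C {#e#}"
    unfolding rank_below_def
  proof (intro exI[of _ u] conjI ballI impI)
    fix x y assume xy: "x \<in> ?C" "y \<in> ?C" "(x, y) \<in> U"
    then have "f x < f y" using f(2) by blast
    moreover have "f x = w + u x" "f y = w + u y" using u xy by blast+
    ultimately show "u x < u y" by simp
  qed (use u in blast)
  then have C: "rank_below R ?C (g e)" using add.prems(2)[of ?C e] by simp
  have "A = ?C \<union> ?B" by auto
  with rank_below_Un[OF assms(1) C B] show ?case by simp
qed

lemma replicate_mset_Suc_gt:
  fixes E :: "'e::wellorder"
  assumes "\<And>x. x \<in># M \<Longrightarrow> x < E"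
  shows "replicate_mset n E + M < replicate_mset (Suc n) E"
proof -
  have "replicate_mset n E + M < replicate_mset n E + {#E#}"
    using assms by (intro add_strict_left_mono) simp
  then show ?thesis by simp
qed

text \<open>
  If \<open>U i\<close> has rank at most \<open>\<omega>\<close> to the \<open>e i\<close> and \<open>R\<close> were covered by the relations \<open>U i\<close>, then the
  rank of \<open>R\<close> would be bounded by their natural product, \<open>\<omega>\<close> to the sum of the \<open>e i\<close>. It suffices
  that the chains avoiding all \<open>U i\<close> have bounded length \<open>n\<close>; this costs a factor \<open>n\<close>.
\<close>

definition free_chain :: "'x rel \<Rightarrow> ('i \<Rightarrow> 'x rel) \<Rightarrow> 'i set \<Rightarrow> 'x set \<Rightarrow> bool"
  where "free_chain R U I H \<longleftrightarrow> finite H \<and> (\<forall>x\<in>H. \<forall>y\<in>H. x \<noteq> y \<longrightarrow> (x, y) \<in> R \<or> (y, x) \<in> R) \<and>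
    (\<forall>x\<in>H. \<forall>y\<in>H. (x, y) \<in> R \<longrightarrow> (\<forall>i\<in>I. (x, y) \<notin> U i))"

lemma rank_below_cover:
  fixes e :: "'i \<Rightarrow> 'e::{wellorder,ordered_cancel_comm_monoid_add}"
  assumes "trans R" "irrefl R" "finite I"
    and "\<And>i. i \<in> I \<Longrightarrow> rank_below (U i) A {#e i#}"
    and "\<And>H. H \<subseteq> A \<Longrightarrow> free_chain R U I H \<Longrightarrow> card H \<le> n"
  shows "rank_below R A (replicate_mset n (sum e I))"
proof -
  have "rank_below R A (replicate_mset n E)"
    if "sum e I = E" "\<And>i. i \<in> I \<Longrightarrow> rank_below (U i) A {#e i#}"
      "\<And>H. H \<subseteq> A \<Longrightarrow> free_chain R U I H \<Longrightarrow> card H \<le> n" for e :: "'i \<Rightarrow> 'e" and E n A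
    using that
  \<comment> \<open>Outer induction on the exponent, inner induction on the length of free
    chains.\<close>
  proof (induction E arbitrary: n A e rule: less_induct)
    case (less E)
    from less.prems show ?case
    proof (induction n arbitrary: A)
      case 0
      have "A = {}"
      proof (rule ccontr)
        assume "A \<noteq> {}"
        then obtain x where "x \<in> A" by blast
        then have "card {x} \<le> 0"
          using \<open>irrefl R\<close> by (intro "0.prems"(3)) (auto simp: free_chain_def irrefl_def)
        then show False by simp
      qed
      then show ?case by (simp add: rank_below_empty)
    next
      case (Suc n)
      show ?case
      proof (rule rank_below_step[OF \<open>trans R\<close>])
        \<comment> \<open>Split the elements below \<open>y\<close>. In \<open>?B\<close> a free
          chain can be prolonged by \<open>y\<close>, so its length is at most \<open>n\<close>; in
          \<open>?A i\<close> every element is below \<open>y\<close> in \<open>U i\<close>.\<close>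
        fix y assume "y \<in> A"
        let ?A = "\<lambda>i. {z \<in> A. (z, y) \<in> R \<and> (z, y) \<in> U i}"
        let ?B = "{z \<in> A. (z, y) \<in> R \<and> (\<forall>i\<in>I. (z, y) \<notin> U i)}"
        have B: "rank_below R ?B (replicate_mset n E)"
        proof (rule Suc.IH)
          fix H assume H: "H \<subseteq> ?B" "free_chain R U I H"
          have "(y, z) \<notin> R" if "z \<in> insert y H" for z
            using that \<open>irrefl R\<close> \<open>trans R\<close> H(1) by (auto simp: irrefl_def dest: transD)
          then have "free_chain R U I (insert y H)"
            using H unfolding free_chain_def by auto
          then have "card (insert y H) \<le> Suc n"
            using H(1) \<open>y \<in> A\<close> by (intro Suc.prems(3)) auto
          moreover have "y \<notin> H" "finite H"
            using H \<open>irrefl R\<close> by (auto simp: irrefl_def free_chain_def)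
          ultimately show "card H \<le> n" by simp
        next
          fix i assume "i \<in> I"
          then show "rank_below (U i) ?B {#e i#}"
            by (rule rank_below_mono[OF Suc.prems(2)]) auto
        qed fact
        have "\<exists>w. rank_below R (?A i) w \<and> (\<forall>x\<in>#w. x < E)" if "i \<in> I" for i
        proof -
          obtain f where f: "\<forall>x\<in>A. f x < {#e i#}" "\<forall>x\<in>A. \<forall>z\<in>A. (x, z) \<in> U i \<longrightarrow> f x < f z"
            using Suc.prems(2)[OF \<open>i \<in> I\<close>] unfolding rank_below_def by blast
          let ?E = "\<lambda>d. sum (e(i := d)) I"
          have fy: "x < e i" if "x \<in># f y" for x using that f(1) \<open>y \<in> A\<close> by auto
          have less: "?E d < E" if "d \<in># f y" for d
          proof -
            have "?E d = d + sum e (I - {i})"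
              using \<open>finite I\<close> \<open>i \<in> I\<close> by (subst sum.remove[of _ i]) (auto intro!: sum.cong)
            also have "\<dots> < e i + sum e (I - {i})"
              using fy[OF that] by (rule add_strict_right_mono)
            also have "\<dots> = E"
              using \<open>finite I\<close> \<open>i \<in> I\<close> Suc.prems(1) by (simp add: sum.remove[of _ i])
            finally show ?thesis .
          qed
          \<comment> \<open>The normal form of \<open>f y\<close> cuts \<open>?A i\<close> into
            blocks on which \<open>U i\<close> has exponent \<open>d < e i\<close>. Replacing
            \<open>e i\<close> by \<open>d\<close> lowers the sum below \<open>E\<close>, so the
            outer induction applies to each block.\<close>
          have "rank_below R (?A i) (\<Sum>d\<in>#f y. replicate_mset (Suc n) (?E d))"
          proof (rule rank_below_decompose[OF \<open>trans R\<close>])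
            show "rank_below (U i) (?A i) (f y)"
              using f(2) \<open>y \<in> A\<close> unfolding rank_below_def by blast
          next
            fix B d assume B: "B \<subseteq> ?A i" "d \<in># f y" "rank_below (U i) B {#d#}"
            show "rank_below R B (replicate_mset (Suc n) (?E d))"
            proof (rule less.IH[OF less[OF B(2)] refl])
              fix j assume "j \<in> I"
              show "rank_below (U j) B {#(e(i := d)) j#}"
              proof (cases "j = i")
                case False
                then show ?thesis using rank_below_mono[OF Suc.prems(2)[OF \<open>j \<in> I\<close>], of B "{#e j#}"] B(1) by auto
              qed (use B in simp)
            next
              fix H assume "H \<subseteq> B" "free_chain R U I H"
              then show "card H \<le> Suc n" using B(1) by (intro Suc.prems(3)) auto
            qed
          qed
          moreover have "\<forall>x\<in>#\<Sum>d\<in>#f y. replicate_mset (Suc n) (?E d). x < E"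
            using less by (auto simp: in_replicate_mset split: if_splits)
          ultimately show ?thesis by blast
        qed
        then have "\<forall>i\<in>I. \<exists>w. rank_below R (?A i) w \<and> (\<forall>x\<in>#w. x < E)" by blast
        from bchoice[OF this] obtain w where w: "\<And>i. i \<in> I \<Longrightarrow> rank_below R (?A i) (w i)"
          "\<And>i x. i \<in> I \<Longrightarrow> x \<in># w i \<Longrightarrow> x < E" by blast
        have "rank_below R (?B \<union> (\<Union>i\<in>I. ?A i)) (replicate_mset n E + sum w I)"
          using B rank_below_UN[OF \<open>trans R\<close> \<open>finite I\<close>, of ?A w] w(1)
          by (intro rank_below_Un[OF \<open>trans R\<close>]) auto
        moreover have "{z \<in> A. (z, y) \<in> R} \<subseteq> ?B \<union> (\<Union>i\<in>I. ?A i)" by blast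
        ultimately have "rank_below R {z \<in> A. (z, y) \<in> R} (replicate_mset n E + sum w I)"
          by (rule rank_below_mono) simp
        moreover have "replicate_mset n E + sum w I < replicate_mset (Suc n) E"
          using w(2) \<open>finite I\<close> by (intro replicate_mset_Suc_gt) (auto simp: set_mset_sum)
        ultimately show "\<exists>w'<replicate_mset (Suc n) E. rank_below R {z \<in> A. (z, y) \<in> R} w'" by blast
      qed
    qed
  qed
  then show ?thesis using assms(4,5) by blast
qed

section \<open>Boxes\<close>

text \<open>
  A product of sets with an upwards linear order which only depends on the types of the pairs of
  components, one coordinate at a time. \<open>T\<close> is the type of a pair of components.
\<close>

locale box =
  fixes J :: "'j set" and X :: "'j \<Rightarrow> 'b set" and R :: "('j \<Rightarrow> 'b) rel"
    and T :: "'b \<Rightarrow> 'b \<Rightarrow> 'q"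
  assumes finite_J: "finite J"
    and finite_types: "finite (range (case_prod T))"
    and T_diag: "u \<in> J \<Longrightarrow> a \<in> X u \<Longrightarrow> b \<in> X u \<Longrightarrow> T a a = T b b"
    and T_sym: "T a b = T c d \<Longrightarrow> T b a = T d c"
    and R_carrier: "R \<subseteq> PiE J X \<times> PiE J X"
    and R_types: "(x, y) \<in> R \<Longrightarrow> x' \<in> PiE J X \<Longrightarrow> y' \<in> PiE J X \<Longrightarrow>
      (\<And>u. u \<in> J \<Longrightarrow> T (x' u) (y' u) = T (x u) (y u)) \<Longrightarrow> (x', y') \<in> R"
    and trans_R: "trans R" and irrefl_R: "irrefl R"
    and upward: "(x, y) \<in> R \<Longrightarrow> (x, z) \<in> R \<Longrightarrow> y = z \<or> (y, z) \<in> R \<or> (z, y) \<in> R"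
begin

abbreviation Z :: "('j \<Rightarrow> 'b) set"
  where "Z \<equiv> PiE J X"

definition mix :: "'j set \<Rightarrow> ('j \<Rightarrow> 'b) \<Rightarrow> ('j \<Rightarrow> 'b) \<Rightarrow> 'j \<Rightarrow> 'b"
  where "mix S x y = override_on y x S"

lemma mix_apply: "mix S x y u = (if u \<in> S then x u else y u)"
  by (simp add: mix_def override_on_def)

lemma mix_in: "x \<in> Z \<Longrightarrow> y \<in> Z \<Longrightarrow> S \<subseteq> J \<Longrightarrow> mix S x y \<in> Z"
  by (auto simp: PiE_iff mix_apply extensional_def)

lemma mix_eq:
  assumes "\<And>u. u \<in> S \<Longrightarrow> x u = y u"
  shows "mix S x y = y"
  using assms by (auto simp: mix_apply)

lemma T_diag': "u \<in> J \<Longrightarrow> x \<in> Z \<Longrightarrow> y \<in> Z \<Longrightarrow> T (x u) (x u) = T (y u) (y u)"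
  using T_diag by (meson PiE_mem)

text \<open>The order induced on the \<open>S\<close>-parts, with the remaining coordinates filled
  from \<open>y\<close>. By \<open>U_iff\<close> any other filling gives the same relation.\<close>

definition U :: "'j set \<Rightarrow> ('j \<Rightarrow> 'b) rel"
  where "U S = {(x, y). x \<in> Z \<and> y \<in> Z \<and> (mix S x y, y) \<in> R}"

lemma T_restrict: "(\<lambda>u\<in>J. T (x u) (y u)) \<in> PiE J (\<lambda>_. range (case_prod T))"
  unfolding restrict_PiE_iff by (intro ballI range_eqI[where x = "(x u, y u)" for u]) simp

text \<open>Outside \<open>S\<close> the two mixtures coincide, and the type of a component with
  itself is the same for all elements of \<open>X u\<close>. So changing the filling changes no
  types.\<close>

lemma U_iff:
  assumes "S \<subseteq> J" "x \<in> Z" "y \<in> Z" "z \<in> Z"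
  shows "(x, y) \<in> U S \<longleftrightarrow> (mix S x z, mix S y z) \<in> R"
proof -
  have types: "T (mix S x y u) (y u) = T (mix S x z u) (mix S y z u)" if "u \<in> J" for u
    using T_diag'[OF that assms(3,4)] by (simp add: mix_apply)
  show ?thesis
  proof
    assume "(x, y) \<in> U S"
    then have "(mix S x y, y) \<in> R" by (simp add: U_def)
    then show "(mix S x z, mix S y z) \<in> R"
      by (rule R_types) (simp_all add: mix_in assms types)
  next
    assume "(mix S x z, mix S y z) \<in> R"
    then have "(mix S x y, y) \<in> R"
      by (rule R_types) (simp_all add: mix_in assms types)
    then show "(x, y) \<in> U S" using assms by (simp add: U_def)
  qed
qed

lemma UI: "(x, y) \<in> R \<Longrightarrow> (\<And>u. u \<in> J - S \<Longrightarrow> x u = y u) \<Longrightarrow> (x, y) \<in> U S"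
proof -
  assume xy: "(x, y) \<in> R" "\<And>u. u \<in> J - S \<Longrightarrow> x u = y u"
  then have Z: "x \<in> Z" "y \<in> Z" using R_carrier by auto
  have "mix S x y u = x u" for u
    using Z xy(2)[of u] by (cases "u \<in> J") (auto simp: mix_apply PiE_iff extensional_def)
  then have "mix S x y = x" by blast
  with xy(1) Z show ?thesis by (simp add: U_def)
qed

text \<open>
  Since \<open>h\<close> and \<open>h'\<close> have the same type over \<open>x\<close>, so has every mixture of them; hence all mixtures
  lie above \<open>x\<close> and are comparable with \<open>h\<close>. As no \<open>U (G i)\<close> relates \<open>h\<close> to \<open>h'\<close>, replacing
  the components of \<open>h\<close> by those of \<open>h'\<close> group by group never increases the element.
\<close>

lemma free_triple:
  assumes "finite I" "disjoint_family_on G I" "(\<Union>i\<in>I. G i) = J"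
    and R: "(x, h) \<in> R" "(x, h') \<in> R" "(h, h') \<in> R"
    and types: "\<And>u. u \<in> J \<Longrightarrow> T (x u) (h u) = T (x u) (h' u)"
    and free: "\<And>i. i \<in> I \<Longrightarrow> (h, h') \<notin> U (G i)"
  shows False
proof -
  have Z: "x \<in> Z" "h \<in> Z" "h' \<in> Z" using R R_carrier by auto
  have "mix (\<Union>i\<in>F. G i) h' h = h \<or> (mix (\<Union>i\<in>F. G i) h' h, h) \<in> R"
    if "finite F" "F \<subseteq> I" for F
    using that
  proof (induction rule: finite_induct)
    case empty
    show ?case using mix_eq[of "{}" h' h] by simp
  next
    case (insert i F)
    let ?z = "mix (\<Union>i\<in>F. G i) h' h" and ?m = "mix (G i) h' h"
    have sub: "G i \<subseteq> J" "(\<Union>i\<in>F. G i) \<subseteq> J" using insert.prems assms(3) by auto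
    have "G i \<inter> G j = {}" if "j \<in> F" for j
      using that insert.hyps insert.prems by (intro disjoint_family_onD[OF assms(2)]) auto
    then have "u \<notin> (\<Union>i\<in>F. G i)" if "u \<in> G i" for u using that by blast
    then have zh: "?z u = h u" if "u \<in> G i" for u using that by (simp add: mix_apply)
    have zZ: "?z \<in> Z" using Z sub by (simp add: mix_in)
    have eq: "mix (\<Union>i\<in>insert i F. G i) h' h = mix (G i) h' ?z"
      by (auto simp: mix_apply)
    have "(x, ?m) \<in> R"
      using R(1) by (rule R_types) (use Z sub types in \<open>auto simp: mix_in mix_apply\<close>)
    then consider "?m = h" | "(h, ?m) \<in> R" | "(?m, h) \<in> R" using upward R(1) by blast
    then have "mix (G i) h' ?z = ?z \<or> (mix (G i) h' ?z, ?z) \<in> R"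
    proof cases
      case 1
      then have "h' u = h u" if "u \<in> G i" for u using that by (metis mix_apply)
      then show ?thesis using zh by (intro disjI1 mix_eq) simp
    next
      case 2
      moreover have "mix (G i) h h = h" by (simp add: mix_eq)
      ultimately have "(h, h') \<in> U (G i)" using U_iff[OF sub(1) Z(2,3,2)] by simp
      with free[of i] insert.prems show ?thesis by simp
    next
      case 3
      then have "(h', h) \<in> U (G i)" using Z by (simp add: U_def)
      then have "(mix (G i) h' ?z, mix (G i) h ?z) \<in> R" using U_iff[OF sub(1) Z(3,2) zZ] by simp
      moreover have "mix (G i) h ?z = ?z" using zh by (intro mix_eq) simp
      ultimately show ?thesis by simp
    qed
    then show ?case unfolding eq using insert trans_R by (auto dest: transD)
  qed
  from this[OF assms(1)] have "mix J h' h = h \<or> (mix J h' h, h) \<in> R" using assms(3) by simp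
  moreover have "mix J h' h u = h' u" for u
    using Z by (auto simp: mix_apply PiE_iff extensional_def)
  then have "mix J h' h = h'" by blast
  ultimately show False using R(3) trans_R irrefl_R by (auto simp: irrefl_def dest: transD)
qed

text \<open>Let \<open>x\<close> be the least element of the chain. By \<open>free_triple\<close>
  the other elements have distinct types over \<open>x\<close>, so there are at most as many as type
  vectors; \<open>Suc\<close> counts \<open>x\<close>.\<close>

lemma card_free_chain:
  assumes "finite I" "disjoint_family_on G I" "(\<Union>i\<in>I. G i) = J"
    and "H \<subseteq> Z" "free_chain R (\<lambda>i. U (G i)) I H"
  shows "card H \<le> Suc (card (PiE J (\<lambda>_. range (case_prod T))))"
proof (cases "H = {}")
  case False
  have H: "finite H" "\<And>x y. x \<in> H \<Longrightarrow> y \<in> H \<Longrightarrow> x \<noteq> y \<Longrightarrow> (x, y) \<in> R \<or> (y, x) \<in> R"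
    "\<And>x y i. x \<in> H \<Longrightarrow> y \<in> H \<Longrightarrow> (x, y) \<in> R \<Longrightarrow> i \<in> I \<Longrightarrow> (x, y) \<notin> U (G i)"
    using assms(5) unfolding free_chain_def by blast+
  have "asymp_on H (\<lambda>x y. (x, y) \<in> R)" "transp_on H (\<lambda>x y. (x, y) \<in> R)"
    using trans_R irrefl_R by (auto simp: irrefl_def intro!: asymp_onI transp_onI dest: transD)
  from Finite_Set.bex_min_element[OF \<open>finite H\<close> this False]
  obtain x where "x \<in> H" "\<forall>y\<in>H. y \<noteq> x \<longrightarrow> (y, x) \<notin> R" by blast
  then have x: "x \<in> H" "\<And>y. y \<in> H \<Longrightarrow> y \<noteq> x \<Longrightarrow> (x, y) \<in> R"
    using H(2)[of x] by auto
  let ?\<phi> = "\<lambda>h. \<lambda>u\<in>J. T (x u) (h u)"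
  have "inj_on ?\<phi> (H - {x})"
  proof (rule inj_onI, rule ccontr)
    fix h h' assume h: "h \<in> H - {x}" "h' \<in> H - {x}" "?\<phi> h = ?\<phi> h'" "h \<noteq> h'"
    have types: "T (x u) (h u) = T (x u) (h' u)" if "u \<in> J" for u
      using that fun_cong[OF h(3), of u] by simp
    from H(2)[of h h'] h consider "(h, h') \<in> R" | "(h', h) \<in> R" by blast
    then show False
    proof cases
      case 1
      show False
        by (rule free_triple[OF assms(1-3), of x h h']) (use h x H(3) types 1 in auto)
    next
      case 2
      show False
        by (rule free_triple[OF assms(1-3), of x h' h]) (use h x H(3) types 2 in auto)
    qed
  qed
  moreover have "?\<phi> ` (H - {x}) \<subseteq> PiE J (\<lambda>_. range (case_prod T))" by (intro image_subsetI T_restrict)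
  ultimately have "card (H - {x}) \<le> card (PiE J (\<lambda>_. range (case_prod T)))"
    using finite_PiE[OF finite_J finite_types] by (rule card_inj_on_le)
  then show ?thesis using x(1) \<open>finite H\<close> by (simp add: card_Diff_singleton)
qed simp

lemma rank_below_groups:
  fixes e :: "'i \<Rightarrow> 'e::{wellorder,ordered_cancel_comm_monoid_add}"
  assumes "finite I" "disjoint_family_on G I" "(\<Union>i\<in>I. G i) = J"
    and "\<And>i. i \<in> I \<Longrightarrow> rank_below (U (G i)) Z {#e i#}"
  shows "\<exists>n. rank_below R Z (replicate_mset n (sum e I))"
  by (rule exI, rule rank_below_cover[OF trans_R irrefl_R assms(1), where U = "\<lambda>i. U (G i)"])
    (fact assms(4), rule card_free_chain[OF assms(1-3)])

lemma rank_below_fibres: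
  fixes e :: "'e::{wellorder,ordered_cancel_comm_monoid_add}"
  assumes "\<And>u. u \<in> J \<Longrightarrow> rank_below (U {u}) Z {#e#}"
  shows "\<exists>n. rank_below R Z (replicate_mset n (\<Sum>u\<in>J. e))"
  by (rule rank_below_groups[where G = "\<lambda>u. {u}"])
    (auto simp: disjoint_family_on_def finite_J assms)

definition fibre_types :: "'j \<Rightarrow> 'q set"
  where "fibre_types u = {T (x u) (y u) | x y. (x, y) \<in> U {u}}"

text \<open>The relation on a single coordinate depends on types alone, which gives it the form
  \<open>piece_rel\<close> when the components are trees.\<close>

definition fibre :: "'j \<Rightarrow> 'b rel"
  where "fibre u = {(a, b). T a b \<in> fibre_types u}"

lemma rank_below_U_singleton:
  assumes "rank_below (fibre u) (X u) w" "u \<in> J"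
  shows "rank_below (U {u}) Z w"
  using assms(1) order_refl
  by (rule rank_below_map[where g = "\<lambda>x. x u"]) (use assms(2) in \<open>auto simp: fibre_def fibre_types_def\<close>)

text \<open>Varying only the component of \<open>z\<close> at \<open>u\<close> embeds the fibre into
  the box.\<close>

lemma rank_below_fibre:
  assumes "rank_below R Z w" "z \<in> Z" "u \<in> J"
  shows "rank_below (fibre u) (X u) w"
  using assms(1) order_refl
proof (rule rank_below_map[where g = "\<lambda>a. z(u := a)"])
  have in_Z: "z(u := a) \<in> Z" if "a \<in> X u" for a
    using that assms by (auto simp: PiE_iff extensional_def)
  then show "(\<lambda>a. z(u := a)) ` X u \<subseteq> Z" by blast
  fix a b assume ab: "a \<in> X u" "b \<in> X u" "(a, b) \<in> fibre u"
  then obtain x y where xy: "(x, y) \<in> U {u}" "T a b = T (x u) (y u)"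
    by (auto simp: fibre_def fibre_types_def)
  then have "(mix {u} x z, mix {u} y z) \<in> R"
    using U_iff[of "{u}" x y z] assms by (auto simp: U_def)
  then show "(z(u := a), z(u := b)) \<in> R"
    by (rule R_types) (use ab in_Z xy(2) in \<open>auto simp: mix_apply\<close>)
qed

end

section \<open>Boxes with finitely many elements above each element\<close>

locale forest_box = box J X R T
  for J :: "'j set" and X :: "'j \<Rightarrow> 'b set" and R :: "('j \<Rightarrow> 'b) rel"
    and T :: "'b \<Rightarrow> 'b \<Rightarrow> 'q" +
  assumes finite_up: "finite {y. (x, y) \<in> R}"
begin

definition infinite_down :: "'j set \<Rightarrow> bool"
  where "infinite_down S \<longleftrightarrow> (\<exists>y. infinite {x. (x, y) \<in> R \<and> (\<forall>u\<in>J - S. x u = y u)})"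

text \<open>There are finitely many type vectors over \<open>y\<close>, so by the pigeonhole
  principle infinitely many of the predecessors share one.\<close>

lemma infinite_downE:
  assumes "infinite_down S"
  obtains y A where "infinite A" "y \<in> Z" "\<And>x. x \<in> A \<Longrightarrow> (x, y) \<in> R"
    "\<And>x u. x \<in> A \<Longrightarrow> u \<notin> S \<Longrightarrow> x u = y u"
    "\<And>x x' u. x \<in> A \<Longrightarrow> x' \<in> A \<Longrightarrow> u \<in> J \<Longrightarrow> T (x u) (y u) = T (x' u) (y u)"
proof -
  obtain y where y: "infinite {x. (x, y) \<in> R \<and> (\<forall>u\<in>J - S. x u = y u)}" (is "infinite ?A")
    using assms unfolding infinite_down_def by blast
  let ?\<phi> = "\<lambda>x. \<lambda>u\<in>J. T (x u) (y u)"
  have "?\<phi> ` ?A \<subseteq> PiE J (\<lambda>_. range (case_prod T))" by (intro image_subsetI T_restrict)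
  then have "finite (?\<phi> ` ?A)"
    using finite_PiE[OF finite_J finite_types] by (rule finite_subset)
  from pigeonhole_infinite[OF y this]
  obtain x0 where x0: "x0 \<in> ?A" "infinite {x \<in> ?A. ?\<phi> x = ?\<phi> x0}" (is "infinite ?B") by blast
  show ?thesis
  proof
    show "infinite ?B" by fact
    show "y \<in> Z" using x0 R_carrier by auto
    show "(x, y) \<in> R" if "x \<in> ?B" for x using that by blast
    show "x u = y u" if "x \<in> ?B" "u \<notin> S" for x u
    proof (cases "u \<in> J")
      case False
      have "x \<in> Z" "y \<in> Z" using that(1) R_carrier by auto
      from this[THEN PiE_arb, OF False] show ?thesis by simp
    qed (use that in blast)
    show "T (x u) (y u) = T (x' u) (y u)" if "x \<in> ?B" "x' \<in> ?B" "u \<in> J" for x x' u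
    proof -
      have "?\<phi> x = ?\<phi> x'" using that by simp
      from fun_cong[OF this, of u] show ?thesis using \<open>u \<in> J\<close> by simp
    qed
  qed
qed

text \<open>
  Write an element as \<open>(a, b)\<close> with \<open>a\<close> its \<open>S\<close>-part and \<open>b\<close> its \<open>S'\<close>-part. If \<open>c < a\<close> and \<open>d < b\<close>,
  then \<open>(c, b)\<close> and \<open>(a, d)\<close> both lie above \<open>(c, d)\<close> and are comparable. After passing to infinitely
  many \<open>c\<close> and \<open>d\<close> of constant type, they compare in the same way for all \<open>c\<close> and \<open>d\<close>, so some
  element has infinitely many elements above it.
\<close>

lemma infinite_down_disjoint:
  assumes "S \<subseteq> J" "S' \<subseteq> J" "S \<inter> S' = {}" "infinite_down S" "infinite_down S'"
  shows False
proof -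
  obtain y A where A: "infinite A" "y \<in> Z" "\<And>x. x \<in> A \<Longrightarrow> (x, y) \<in> R"
    "\<And>x u. x \<in> A \<Longrightarrow> u \<notin> S \<Longrightarrow> x u = y u"
    "\<And>x x' u. x \<in> A \<Longrightarrow> x' \<in> A \<Longrightarrow> u \<in> J \<Longrightarrow> T (x u) (y u) = T (x' u) (y u)"
    by (rule infinite_downE[OF assms(4)], rule that)
  obtain y' A' where A': "infinite A'" "y' \<in> Z" "\<And>x. x \<in> A' \<Longrightarrow> (x, y') \<in> R"
    "\<And>x u. x \<in> A' \<Longrightarrow> u \<notin> S' \<Longrightarrow> x u = y' u"
    "\<And>x x' u. x \<in> A' \<Longrightarrow> x' \<in> A' \<Longrightarrow> u \<in> J \<Longrightarrow> T (x u) (y' u) = T (x' u) (y' u)"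
    by (rule infinite_downE[OF assms(5)], rule that)
  \<comment> \<open>The element called \<open>(a, b)\<close> above: \<open>y'\<close> on
    \<open>S'\<close> and \<open>y\<close> elsewhere. Then \<open>?l x\<close> replaces its
    \<open>S\<close>-part and \<open>?m b\<close> its \<open>S'\<close>-part.\<close>
  define z where "z = mix S' y' y"
  let ?l = "\<lambda>x. mix S x z" and ?m = "\<lambda>b. mix S' b z"
  have AZ: "x \<in> Z" if "x \<in> A" for x using A(3)[OF that] R_carrier by auto
  have AZ': "x \<in> Z" if "x \<in> A'" for x using A'(3)[OF that] R_carrier by auto
  have z: "z \<in> Z" unfolding z_def using A A' assms by (simp add: mix_in)
  have lZ: "?l x \<in> Z" if "x \<in> A" for x using AZ[OF that] z assms by (simp add: mix_in)
  have mZ: "?m b \<in> Z" if "b \<in> A'" for b using AZ'[OF that] z assms by (simp add: mix_in)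
  have comparable: "(?l x, ?m b) \<in> R \<or> (?m b, ?l x) \<in> R" if "x \<in> A" "b \<in> A'" for x b
  proof -
    have "(b, y') \<in> U S'" using A' that by (intro UI) auto
    then have "(mix S' b (?l x), mix S' y' (?l x)) \<in> R"
      using U_iff[OF assms(2) AZ'[OF that(2)] A'(2) lZ[OF that(1)]] by simp
    moreover have "mix S' y' (?l x) = ?l x"
      using assms(3) by (intro mix_eq) (auto simp: mix_apply z_def)
    ultimately have 1: "(mix S' b (?l x), ?l x) \<in> R" by simp
    have "(x, y) \<in> U S" using A that by (intro UI) auto
    then have "(mix S x (?m b), mix S y (?m b)) \<in> R"
      using U_iff[OF assms(1) AZ[OF that(1)] A(2) mZ[OF that(2)]] by simp
    moreover have "mix S y (?m b) = ?m b"
      using assms(3) by (intro mix_eq) (auto simp: mix_apply z_def)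
    moreover have "mix S x (?m b) = mix S' b (?l x)"
      by (rule ext) (use assms(3) in \<open>auto simp: mix_apply\<close>)
    ultimately have 2: "(mix S' b (?l x), ?m b) \<in> R" by simp
    have "?l x \<noteq> ?m b"
    proof
      assume eq: "?l x = ?m b"
      have "x u = y u" for u
      proof (cases "u \<in> S")
        case True
        then have "u \<notin> S'" using assms(3) by blast
        with True fun_cong[OF eq, of u] show ?thesis by (simp add: mix_apply z_def)
      qed (use A(4) that in blast)
      then have "x = y" by blast
      with A(3)[OF that(1)] irrefl_R show False by (simp add: irrefl_def)
    qed
    with upward[OF 1 2] show ?thesis by blast
  qed
  have types: "T (?l x u) (?m b u) = T (?l x' u) (?m b' u)"
    if "x \<in> A" "b \<in> A'" "x' \<in> A" "b' \<in> A'" "u \<in> J" for x b x' b' u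
  proof -
    consider "u \<in> S" "u \<notin> S'" | "u \<notin> S" "u \<in> S'" | "u \<notin> S" "u \<notin> S'" using assms(3) by blast
    then show ?thesis
    proof cases
      case 1
      then show ?thesis using A(5)[OF that(1,3,5)] by (simp add: mix_apply z_def)
    next
      case 2
      then show ?thesis using T_sym[OF A'(5)[OF that(2,4,5)]] by (simp add: mix_apply z_def)
    qed (simp add: mix_apply)
  qed
  have inj_l: "inj_on ?l A"
  proof (rule inj_onI, rule ext)
    fix x x' u assume x: "x \<in> A" "x' \<in> A" and eq: "?l x = ?l x'"
    show "x u = x' u"
      using A(4)[OF x(1), of u] A(4)[OF x(2), of u] fun_cong[OF eq, of u]
      by (cases "u \<in> S") (simp_all add: mix_apply)
  qed
  have inj_m: "inj_on ?m A'"
  proof (rule inj_onI, rule ext)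
    fix x x' u assume x: "x \<in> A'" "x' \<in> A'" and eq: "?m x = ?m x'"
    show "x u = x' u"
      using A'(4)[OF x(1), of u] A'(4)[OF x(2), of u] fun_cong[OF eq, of u]
      by (cases "u \<in> S'") (simp_all add: mix_apply)
  qed
  have "A \<noteq> {}" "A' \<noteq> {}" using A(1) A'(1) by auto
  then obtain x0 b0 where "x0 \<in> A" "b0 \<in> A'" by blast
  from comparable[OF this] show False
  proof
    assume R0: "(?l x0, ?m b0) \<in> R"
    have "(?l x0, ?m b) \<in> R" if "b \<in> A'" for b
      using R0 lZ[OF \<open>x0 \<in> A\<close>] mZ[OF that]
      by (rule R_types) (rule types[OF \<open>x0 \<in> A\<close> that \<open>x0 \<in> A\<close> \<open>b0 \<in> A'\<close>])
    then have "?m ` A' \<subseteq> {y. (?l x0, y) \<in> R}" by blast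
    then have "finite (?m ` A')" using finite_up by (rule finite_subset)
    then show False using finite_image_iff[OF inj_m] A'(1) by simp
  next
    assume R0: "(?m b0, ?l x0) \<in> R"
    have "(?m b0, ?l x) \<in> R" if "x \<in> A" for x
      using R0 mZ[OF \<open>b0 \<in> A'\<close>] lZ[OF that]
      by (rule R_types) (rule T_sym[OF types[OF that \<open>b0 \<in> A'\<close> \<open>x0 \<in> A\<close> \<open>b0 \<in> A'\<close>]])
    then have "?l ` A \<subseteq> {y. (?m b0, y) \<in> R}" by blast
    then have "finite (?l ` A)" using finite_up by (rule finite_subset)
    then show False using finite_image_iff[OF inj_l] A(1) by simp
  qed
qed

text \<open>The predecessors differing only on \<open>S\<close> form a finite set that grows
  strictly along \<open>U S\<close>, so its cardinality is a rank below omega. The number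
  \<open>n\<close> appears as \<open>replicate_mset n 0\<close>, and omega as
  \<open>{#1#}\<close>.\<close>

lemma rank_below_finite_down:
  assumes "S \<subseteq> J" "\<not> infinite_down S"
  shows "rank_below (U S) Z {#1::nat#}"
proof (cases "Z = {}")
  case False
  then obtain z where z: "z \<in> Z" by blast
  define D where "D x = {w. (w, mix S x z) \<in> R \<and> (\<forall>u\<in>J - S. w u = mix S x z u)}" for x
  have fin: "finite (D x)" for x using assms(2) unfolding D_def infinite_down_def by blast
  have psub: "D x \<subset> D y" if "(x, y) \<in> U S" for x y
  proof -
    have xy: "(mix S x z, mix S y z) \<in> R"
      using that U_iff[OF assms(1) _ _ z, of x y] by (auto simp: U_def)
    then have "mix S x z \<in> D y" by (auto simp: D_def mix_apply)
    moreover have "mix S x z \<notin> D x" using irrefl_R by (auto simp: D_def irrefl_def)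
    moreover have "D x \<subseteq> D y"
      using xy trans_R by (auto simp: D_def mix_apply dest: transD)
    ultimately show ?thesis by blast
  qed
  have mono: "replicate_mset m 0 < (replicate_mset n 0 :: nat multiset)" if "m < n" for m n
    by (rule lift_Suc_mono_less[OF _ that]) (simp add: le_multiset_right_total)
  show ?thesis unfolding rank_below_def
    by (intro exI[of _ "\<lambda>x. replicate_mset (card (D x)) 0"] conjI ballI impI)
      (auto intro!: mono psubset_card_mono psub fin)
qed (simp add: rank_below_empty)

text \<open>Add coordinates one by one. The empty set is not \<open>infinite_down\<close>, since
  predecessors differing nowhere would contradict irreflexivity; so some coordinate \<open>u\<close>
  is the first to produce infinitely many predecessors.\<close>

lemma infinite_down_split:
  assumes "infinite_down J"
  shows "\<exists>S u. S \<subseteq> J \<and> u \<in> J - S \<and> \<not> infinite_down S \<and> infinite_down (insert u S)"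
proof -
  have "\<exists>S u. S \<subseteq> F \<and> u \<in> F - S \<and> \<not> infinite_down S \<and> infinite_down (insert u S)"
    if "finite F" "infinite_down F" for F
    using that
  proof (induction rule: finite_induct)
    case empty
    then obtain y where "infinite {x. (x, y) \<in> R \<and> (\<forall>u\<in>J - {}. x u = y u)}"
      unfolding infinite_down_def by blast
    from infinite_imp_nonempty[OF this] obtain x where x: "(x, y) \<in> R" "\<forall>u\<in>J. x u = y u" by auto
    then have "x \<in> Z" "y \<in> Z" using R_carrier by auto
    then have "x = y" by (rule PiE_ext) (use x(2) in simp)
    with x(1) have "(y, y) \<in> R" by simp
    with irrefl_R show ?case by (simp add: irrefl_def)
  next
    case (insert u F)
    then show ?case by (cases "infinite_down F") blast+
  qed
  then show ?thesis using finite_J assms by blast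
qed

text \<open>
  By disjointness the coordinates can be cut into three groups, of which the first and the last
  have rank at most \<open>\<omega>\<close> and the middle one is a single coordinate. Hence the exponent grows by a
  constant independent of the number of coordinates.
\<close>

lemma rank_below_forest:
  assumes "\<And>u. u \<in> J \<Longrightarrow> rank_below (U {u}) Z {#k::nat#}"
  shows "\<exists>n. rank_below R Z (replicate_mset n (k + 2))"
proof (cases "infinite_down J")
  case True
  from infinite_down_split[OF this] obtain S u
    where S: "S \<subseteq> J" "u \<in> J" "u \<notin> S" "\<not> infinite_down S" "infinite_down (insert u S)" by blast
  define G where "G i = (if i = 0 then S else if i = 1 then {u} else J - insert u S)" for i :: nat
  define e where "e i = (if i = 1 then k else 1)" for i :: nat
  have rest: "\<not> infinite_down (J - insert u S)"
    using infinite_down_disjoint[of "insert u S" "J - insert u S"] S by blast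
  have "\<exists>n. rank_below R Z (replicate_mset n (sum e {0, 1, 2}))"
  proof (rule rank_below_groups)
    show "disjoint_family_on G {0, 1, 2}" using S by (auto simp: disjoint_family_on_def G_def)
    show "(\<Union>i\<in>{0, 1, 2}. G i) = J" using S by (auto simp: G_def)
    fix i :: nat assume "i \<in> {0, 1, 2}"
    then consider "i = 0" | "i = 1" | "i = 2" by blast
    then show "rank_below (U (G i)) Z {#e i#}"
    proof cases
      case 1
      then show ?thesis using rank_below_finite_down[of S] S by (simp add: G_def e_def)
    next
      case 2
      then show ?thesis using assms[of u] S by (simp add: G_def e_def)
    next
      case 3
      then show ?thesis using rank_below_finite_down[OF _ rest] by (auto simp: G_def e_def)
    qed
  qed simp
  then show ?thesis by (simp add: e_def)
next
  case False
  \<comment> \<open>The whole of \<open>J\<close> serves as one group here, because \<open>R\<close>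
    is contained in \<open>U J\<close>.\<close>
  have "rank_below R Z {#1::nat#}"
    using rank_below_finite_down[OF subset_refl False] order_refl
    by (rule rank_below_map[where g = "\<lambda>x. x"]) (auto intro: UI)
  then have "rank_below R Z (replicate_mset 1 (k + 2))"
    by (rule rank_below_mono) simp_all
  then show ?thesis by blast
qed

end

section \<open>Trees and runs\<close>

definition subtree :: "'s btree \<Rightarrow> bool list \<Rightarrow> 's btree"
  where "subtree t u = (\<lambda>v. t (u @ v))"

definition prefix_closed :: "'s btree \<Rightarrow> bool"
  where "prefix_closed t \<longleftrightarrow> (\<forall>u v. u @ v \<in> dom t \<longrightarrow> u \<in> dom t)"

lemma prefix_closedD: "prefix_closed t \<Longrightarrow> t u = None \<Longrightarrow> t (u @ v) = None"
  unfolding prefix_closed_def by (metis domIff)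

lemma prefix_closed_subtree: "prefix_closed t \<Longrightarrow> prefix_closed (subtree t u)"
  unfolding prefix_closed_def subtree_def by (metis append_assoc domIff)

lemma subtree_subtree: "subtree (subtree t u) v = subtree t (u @ v)"
  by (simp add: subtree_def)

lemma subtree_Nil: "subtree t [] = t"
  by (simp add: subtree_def)

text \<open>The value \<open>{None}\<close> for a missing tree matches the \<open>None\<close> of a
  transition for an absent child, and differs from the empty set, which means that the tree exists
  but has no run.\<close>

definition reach :: "'s tree_automaton \<Rightarrow> 's btree \<Rightarrow> nat option set"
  where "reach A t = (if t [] = None then {None} else Some ` {\<rho> [] | \<rho>. is_run A t \<rho>})"

lemma is_runD:
  assumes "is_run A t \<rho>" "t u = Some a"
  shows "(if u @ [False] \<in> dom t then Some (\<rho> (u @ [False])) else None,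
    if u @ [True] \<in> dom t then Some (\<rho> (u @ [True])) else None, a, \<rho> u) \<in> transitions A"
  using assms unfolding is_run_def Let_def by blast

lemma is_run_subtree:
  assumes "is_run A t \<rho>"
  shows "is_run A (subtree t u) (\<lambda>v. \<rho> (u @ v))"
  unfolding is_run_def Let_def
proof (intro allI impI)
  fix v a assume "subtree t u v = Some a"
  then have "t (u @ v) = Some a" by (simp add: subtree_def)
  from is_runD[OF assms this]
  show "(if v @ [False] \<in> dom (subtree t u) then Some (\<rho> (u @ v @ [False])) else None,
      if v @ [True] \<in> dom (subtree t u) then Some (\<rho> (u @ v @ [True])) else None, a, \<rho> (u @ v))
    \<in> transitions A"
    by (simp add: subtree_def dom_def cong: if_cong)
qed

text \<open>Runs restrict to the child subtrees, and conversely runs on these glue together with a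
  state at the root. On an absent child every function is vacuously a run.\<close>

lemma reach_unfold:
  assumes "prefix_closed t" "t [] = Some a"
  shows "reach A t = Some ` {s. \<exists>p\<in>reach A (subtree t [False]). \<exists>q\<in>reach A (subtree t [True]).
    (p, q, a, s) \<in> transitions A}" (is "_ = Some ` ?S")
proof -
  have "s \<in> ?S" if "is_run A t \<rho>" "s = \<rho> []" for s \<rho>
  proof -
    let ?p = "\<lambda>b. if [b] \<in> dom t then Some (\<rho> [b]) else None"
    have "?p b \<in> reach A (subtree t [b])" for b
      using is_run_subtree[OF that(1), of "[b]"] by (force simp: reach_def subtree_def)
    moreover have "(?p False, ?p True, a, s) \<in> transitions A"
      using is_runD[OF that(1) assms(2)] that(2) by (simp cong: if_cong)
    ultimately show ?thesis by blast
  qed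
  moreover have "\<exists>\<rho>. is_run A t \<rho> \<and> s = \<rho> []" if s: "s \<in> ?S" for s
  proof -
    obtain p0 p1 where "p0 \<in> reach A (subtree t [False])" "p1 \<in> reach A (subtree t [True])"
      "(p0, p1, a, s) \<in> transitions A" using s by blast
    moreover define p where "p b = (if b then p1 else p0)" for b
    ultimately have p: "p b \<in> reach A (subtree t [b])" "(p False, p True, a, s) \<in> transitions A" for b
      by simp_all
    have "\<exists>\<rho>. is_run A (subtree t [b]) \<rho> \<and> p b = (if [b] \<in> dom t then Some (\<rho> []) else None)" for b
    proof (cases "t [b]")
      case None
      then have "subtree t [b] v = None" for v
        using prefix_closedD[OF assms(1) None] by (simp add: subtree_def)
      then have "is_run A (subtree t [b]) \<rho>" for \<rho> by (simp add: is_run_def)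
      moreover have "p b = None" using p(1)[of b] None by (simp add: reach_def subtree_def)
      ultimately show ?thesis using None by auto
    next
      case (Some c)
      then show ?thesis using p(1)[of b] by (auto simp: reach_def subtree_def)
    qed
    then obtain \<rho> where \<rho>: "\<And>b. is_run A (subtree t [b]) (\<rho> b)"
      "\<And>b. p b = (if [b] \<in> dom t then Some (\<rho> b []) else None)" by metis
    let ?\<rho> = "\<lambda>v. case v of [] \<Rightarrow> s | b # w \<Rightarrow> \<rho> b w"
    have "is_run A t ?\<rho>"
      unfolding is_run_def Let_def
    proof (intro allI impI)
      fix v c assume v: "t v = Some c"
      show "(if v @ [False] \<in> dom t then Some (?\<rho> (v @ [False])) else None,
          if v @ [True] \<in> dom t then Some (?\<rho> (v @ [True])) else None, c, ?\<rho> v) \<in> transitions A"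
      proof (cases v)
        case Nil
        then show ?thesis using p(2) \<rho>(2)[of False] \<rho>(2)[of True] v assms(2) by (simp cong: if_cong)
      next
        case (Cons b w)
        then have "subtree t [b] w = Some c" using v by (simp add: subtree_def)
        from is_runD[OF \<rho>(1) this] show ?thesis
          by (simp add: Cons subtree_def dom_def cong: if_cong)
      qed
    qed
    then show ?thesis by (intro exI[of _ ?\<rho>]) simp
  qed
  ultimately have "{\<rho> [] | \<rho>. is_run A t \<rho>} = ?S" by blast
  then show ?thesis using assms(2) by (simp add: reach_def)
qed

lemma reach_cong_children:
  assumes "prefix_closed t" "prefix_closed t'" "t [] = t' []"
    and "\<And>b. reach A (subtree t [b]) = reach A (subtree t' [b])"
  shows "reach A t = reach A t'"
proof (cases "t []")
  case None
  then show ?thesis using assms(3) by (simp add: reach_def)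
next
  case (Some a)
  then show ?thesis using assms(3,4) reach_unfold[OF assms(1), of a] reach_unfold[OF assms(2), of a] by simp
qed

section \<open>Cutting a tree along the boundary of a finite domain\<close>

definition boundary :: "bool list set \<Rightarrow> bool list set"
  where "boundary D = {u @ [b] | u b. u \<in> D} - D"

lemma finite_boundary: "finite D \<Longrightarrow> finite (boundary D)"
proof -
  assume "finite D"
  have "{u @ [b] | u b. u \<in> D} = (\<lambda>(u, b). u @ [b]) ` (D \<times> UNIV)" by auto
  then show ?thesis using \<open>finite D\<close> by (simp add: boundary_def)
qed

lemma boundary_prefix:
  assumes "[] \<in> D" "v \<notin> D"
  shows "\<exists>u\<in>boundary D. \<exists>w. v = u @ w"
  using assms(2)
proof (induction v rule: rev_induct)
  case Nil
  then show ?case using assms(1) by simp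
next
  case (snoc b v)
  show ?case
  proof (cases "v \<in> D")
    case True
    with snoc.prems have "v @ [b] \<in> boundary D" by (auto simp: boundary_def)
    then show ?thesis by (metis append_Nil2)
  next
    case False
    then show ?thesis using snoc.IH by (metis append_assoc)
  qed
qed

lemma boundary_append_notin:
  assumes "\<forall>u v. u @ v \<in> D \<longrightarrow> u \<in> D" "u \<in> boundary D"
  shows "u @ w \<notin> D"
  using assms by (auto simp: boundary_def)

lemma boundary_proper_prefix:
  assumes "\<forall>u v. u @ v \<in> D \<longrightarrow> u \<in> D" "u @ w \<in> boundary D" "w \<noteq> []"
  shows "u \<in> D"
proof -
  from assms(2) obtain x b where x: "u @ w = x @ [b]" "x \<in> D" by (auto simp: boundary_def)
  with assms(3) have "x = u @ butlast w" by (metis butlast_append butlast_snoc)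
  with x(2) assms(1) show ?thesis by blast
qed

text \<open>One of the two nodes is a prefix of the other, and proper prefixes of boundary nodes lie
  in \<open>D\<close>.\<close>

lemma boundary_unique:
  assumes "\<forall>u v. u @ v \<in> D \<longrightarrow> u \<in> D" "u \<in> boundary D" "u' \<in> boundary D" "u @ w = u' @ w'"
  shows "u = u'"
proof -
  have D: "u \<notin> D" "u' \<notin> D" using assms(2,3) by (auto simp: boundary_def)
  from assms(4) obtain x where "u = u' @ x \<and> x @ w = w' \<or> u @ x = u' \<and> w = x @ w'"
    by (auto simp: append_eq_append_conv2)
  then show ?thesis
    using boundary_proper_prefix[of D u' x] boundary_proper_prefix[of D u x] assms(1-3) D by auto
qed

text \<open>Reachable states are computed upwards from the boundary: the induction runs on
  \<open>N - length u\<close>, where \<open>N\<close> exceeds all lengths in \<open>D\<close>, so it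
  decreases on passing to children.\<close>

lemma reach_cong:
  assumes "finite D" "[] \<in> D" "prefix_closed t" "prefix_closed t'"
    and "\<And>u. u \<in> D \<Longrightarrow> t u = t' u"
    and "\<And>u. u \<in> boundary D \<Longrightarrow> reach A (subtree t u) = reach A (subtree t' u)"
  shows "reach A t = reach A t'"
proof -
  define N where "N = Suc (Max (length ` D))"
  have N: "length u < N" if "u \<in> D" for u
    unfolding N_def using that \<open>finite D\<close> by (simp add: less_Suc_eq_le)
  have "reach A (subtree t u) = reach A (subtree t' u)" if "u \<in> D \<union> boundary D" for u
    using that
  proof (induction "N - length u" arbitrary: u rule: less_induct)
    case less
    show ?case
    proof (cases "u \<in> D")
      case True
      show ?thesis
      proof (rule reach_cong_children)
        fix b
        have "u @ [b] \<in> D \<union> boundary D" using True by (auto simp: boundary_def)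
        moreover have "N - length (u @ [b]) < N - length u" using N[OF True] by simp
        ultimately show "reach A (subtree (subtree t u) [b]) = reach A (subtree (subtree t' u) [b])"
          unfolding subtree_subtree by (intro less.hyps)
      qed (use assms(3-5) True in \<open>simp_all add: prefix_closed_subtree\<close>, simp add: subtree_def)
    next
      case False
      then show ?thesis using less.prems assms(6) by simp
    qed
  qed
  from this[of "[]"] show ?thesis using assms(2) by (simp add: subtree_Nil)
qed

lemma None_in_reach_iff: "None \<in> reach A t \<longleftrightarrow> t [] = None"
  by (auto simp: reach_def)

lemma finite_range_reach:
  assumes "tree_automaton A"
  shows "finite (range (reach A))"
proof (rule finite_subset)
  show "range (reach A) \<subseteq> Pow (insert None (Some ` states A))"
  proof (intro image_subsetI PowI subsetI)
    fix t p assume "p \<in> reach A t"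
    then consider "p = None" | \<rho> a where "p = Some (\<rho> [])" "is_run A t \<rho>" "t [] = Some a"
      by (auto simp: reach_def split: if_splits)
    then show "p \<in> insert None (Some ` states A)"
    proof cases
      case 2
      from is_runD[OF 2(2,3)] assms have "\<rho> [] \<in> states A" by (auto simp: tree_automaton_def)
      with 2 show ?thesis by simp
    qed simp
  qed
  show "finite (Pow (insert None (Some ` states A)))" using assms by (simp add: tree_automaton_def)
qed

section \<open>Convolutions of two trees\<close>

lemma convolution_pair: "convolution [s, t] u = (if s u = None \<and> t u = None then None else Some [s u, t u])"
  by (auto simp: convolution_def dom_def)

lemma dom_convolution_pair: "dom (convolution [s, t]) = dom s \<union> dom t"
  by (auto simp: convolution_def dom_def)

lemma convolution_pair_inject:
  assumes "convolution [s, t] = convolution [s', t']"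
  shows "s = s'" "t = t'"
proof -
  have "s u = s' u \<and> t u = t' u" for u
    using fun_cong[OF assms, of u] by (auto simp: convolution_pair split: if_splits)
  then show "s = s'" "t = t'" by auto
qed

lemma subtree_convolution: "subtree (convolution [s, t]) u = convolution [subtree s u, subtree t u]"
  by (rule ext) (simp add: subtree_def convolution_pair)

lemma prefix_closed_convolution:
  assumes "prefix_closed s" "prefix_closed t"
  shows "prefix_closed (convolution [s, t])"
  using assms unfolding prefix_closed_def dom_convolution_pair by blast

lemma labeled_tree_root: "labeled_tree \<Sigma> t \<Longrightarrow> [] \<in> dom t"
  unfolding labeled_tree_def by (metis append_Nil ex_in_conv)

lemma labeled_tree_iff:
  "labeled_tree \<Sigma> t \<longleftrightarrow> finite (dom t) \<and> [] \<in> dom t \<and> prefix_closed t \<and> ran t \<subseteq> \<Sigma>"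
  using labeled_tree_root[of \<Sigma> t] by (auto simp: labeled_tree_def prefix_closed_def)

text \<open>Only the label condition of \<open>language\<close> needs an argument: transitions carry
  letters of the alphabet, so the existence of a run implies it.\<close>

lemma convolution_in_language_iff:
  assumes "tree_automaton A" "labeled_tree \<Sigma> s" "labeled_tree \<Sigma> t"
  shows "convolution [s, t] \<in> language A \<longleftrightarrow> reach A (convolution [s, t]) \<inter> Some ` accepting A \<noteq> {}"
proof -
  let ?c = "convolution [s, t]"
  have st: "finite (dom s)" "finite (dom t)" "prefix_closed s" "prefix_closed t" "s [] \<noteq> None" "t [] \<noteq> None"
    using assms by (auto simp: labeled_tree_iff)
  have c: "finite (dom ?c)" "[] \<in> dom ?c" "prefix_closed ?c"
    using st by (auto simp: dom_convolution_pair prefix_closed_convolution)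
  have "labeled_tree (alphabet A) ?c" if "is_run A ?c \<rho>" for \<rho>
  proof -
    have "ran ?c \<subseteq> alphabet A"
    proof
      fix a assume "a \<in> ran ?c"
      then obtain u where "?c u = Some a" by (auto simp: ran_def)
      from is_runD[OF that this] assms(1) show "a \<in> alphabet A" by (auto simp: tree_automaton_def)
    qed
    with c show ?thesis by (simp add: labeled_tree_iff)
  qed
  then have "?c \<in> language A \<longleftrightarrow> (\<exists>\<rho>. is_run A ?c \<rho> \<and> \<rho> [] \<in> accepting A)"
    by (auto simp: language_def)
  moreover have "reach A ?c = Some ` {\<rho> [] | \<rho>. is_run A ?c \<rho>}"
    using st by (auto simp: reach_def convolution_pair)
  moreover have "Some ` S \<inter> Some ` B \<noteq> {} \<longleftrightarrow> (\<exists>x. x \<in> S \<and> x \<in> B)" for S B :: "nat set" by blast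
  ultimately show ?thesis by (simp only: mem_Collect_eq) metis
qed

section \<open>Decomposition of a principal ideal\<close>

text \<open>Both directions are recorded, so the type determines the type of the swapped pair and
  decides the strict order.\<close>

definition pair_type :: "'s option list tree_automaton \<Rightarrow> 's btree \<Rightarrow> 's btree \<Rightarrow>
    nat option set \<times> nat option set"
  where "pair_type A s t = (reach A (convolution [s, t]), reach A (convolution [t, s]))"

text \<open>
  The second component is the type of \<open>s\<close> at a node outside the domain of the parameter tree.
\<close>

definition loop_type :: "'s option list tree_automaton \<Rightarrow> 's btree \<Rightarrow>
    (nat option set \<times> nat option set) \<times> (nat option set \<times> nat option set)"
  where "loop_type A s = (pair_type A s s, pair_type A s Map.empty)"

lemma finite_range_pair_type:
  assumes "tree_automaton A"
  shows "finite (range (case_prod (pair_type A)))"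
proof (rule finite_subset)
  show "range (case_prod (pair_type A)) \<subseteq> range (reach A) \<times> range (reach A)"
    by (auto simp: pair_type_def)
qed (use finite_range_reach[OF assms] in blast)

lemma finite_range_loop_type:
  assumes "tree_automaton A"
  shows "finite (range (loop_type A))"
proof (rule finite_subset)
  show "range (loop_type A) \<subseteq> (range (reach A) \<times> range (reach A)) \<times> (range (reach A) \<times> range (reach A))"
    by (auto simp: loop_type_def pair_type_def)
qed (use finite_range_reach[OF assms] in blast)

lemma loop_type_root:
  assumes "loop_type A s = loop_type A t"
  shows "s [] = None \<longleftrightarrow> t [] = None"
proof -
  have "reach A (convolution [s, s]) = reach A (convolution [t, t])"
    using assms by (simp add: loop_type_def pair_type_def)
  then have "None \<in> reach A (convolution [s, s]) \<longleftrightarrow> None \<in> reach A (convolution [t, t])" by simp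
  then show ?thesis unfolding None_in_reach_iff by (simp add: convolution_pair split: if_splits)
qed

text \<open>\<open>R_iff\<close> speaks of all labeled trees, also those outside \<open>P\<close>.
  Thus a newly assembled tree is shown to belong to \<open>P\<close> by finding it below
  \<open>p\<close>.\<close>

locale tree_order =
  fixes A :: "'s option list tree_automaton" and \<Sigma> :: "'s set"
    and P :: "'s btree set" and R :: "'s btree rel"
  assumes automaton: "tree_automaton A" and finite_alphabet: "finite \<Sigma>"
    and labeled: "x \<in> P \<Longrightarrow> labeled_tree \<Sigma> x"
    and R_iff: "labeled_tree \<Sigma> x \<Longrightarrow> labeled_tree \<Sigma> y \<Longrightarrow>
      (x, y) \<in> R \<longleftrightarrow> convolution [x, y] \<in> language A"
    and partial_order: "partial_order_on P R"
    and comparable: "(x, y) \<in> R - Id \<Longrightarrow> (x, z) \<in> R - Id \<Longrightarrow> (y, z) \<in> R \<or> (z, y) \<in> R"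
begin

lemmas order = partial_order_onD[OF partial_order]

abbreviation L :: "'s btree rel"
  where "L \<equiv> R - Id"

lemma le_carrier: "(x, y) \<in> R \<Longrightarrow> x \<in> P \<and> y \<in> P"
  using order(4) by blast

lemma R_refl: "x \<in> P \<Longrightarrow> (x, x) \<in> R"
  using order(1) by (simp add: refl_on_def)

lemma trans_L: "trans L"
  using order(2,3) by (rule trans_diff_Id)

lemma L_iff: "x \<in> P \<Longrightarrow> (x, y) \<in> L \<longleftrightarrow> (x, y) \<in> R \<and> (y, x) \<notin> R"
  using order(3) R_refl by (auto dest: antisymD)

lemma L_upward: "(x, y) \<in> L \<Longrightarrow> (x, z) \<in> L \<Longrightarrow> y = z \<or> (y, z) \<in> L \<or> (z, y) \<in> L"
  using comparable[of x y z] by auto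

lemma le_types:
  assumes "labeled_tree \<Sigma> x" "labeled_tree \<Sigma> y" "(x', y') \<in> R"
    and "reach A (convolution [x, y]) = reach A (convolution [x', y'])"
  shows "(x, y) \<in> R"
  using assms le_carrier[OF assms(3)] labeled R_iff convolution_in_language_iff[OF automaton] by metis

text \<open>Unlike labeled trees, pieces may be empty: a tree may have no node at a boundary
  position.\<close>

definition pieces :: "(nat option set \<times> nat option set) \<times> (nat option set \<times> nat option set) \<Rightarrow> 's btree set"
  where "pieces q = {s. finite (dom s) \<and> prefix_closed s \<and> ran s \<subseteq> \<Sigma> \<and> loop_type A s = q}"

definition piece_rel :: "(nat option set \<times> nat option set) set \<Rightarrow> 's btree rel"
  where "piece_rel \<Theta> = {(s, t). pair_type A s t \<in> \<Theta>}"

definition class_of :: "'s btree \<Rightarrow> 's btree \<Rightarrow> (bool list \<Rightarrow> 's option) \<times>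
    (bool list \<Rightarrow> (nat option set \<times> nat option set) \<times> (nat option set \<times> nat option set))"
  where "class_of p x = (restrict x (dom p), \<lambda>u\<in>boundary (dom p). loop_type A (subtree x u))"

lemma finite_class_of:
  assumes "p \<in> P"
  shows "finite (class_of p ` {x. (x, p) \<in> R})"
proof (rule finite_subset)
  let ?C = "PiE (dom p) (\<lambda>_. insert None (Some ` \<Sigma>)) \<times> PiE (boundary (dom p)) (\<lambda>_. range (loop_type A))"
  show "class_of p ` {x. (x, p) \<in> R} \<subseteq> ?C"
  proof (intro image_subsetI)
    fix x assume "x \<in> {x. (x, p) \<in> R}"
    then have "ran x \<subseteq> \<Sigma>" using labeled[of x] le_carrier by (auto simp: labeled_tree_iff)
    then have "x u \<in> insert None (Some ` \<Sigma>)" for u by (cases "x u") (auto simp: ran_def)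
    then show "class_of p x \<in> ?C" by (simp add: class_of_def restrict_PiE_iff)
  qed
  have "finite (dom p)" using labeled[OF assms] by (simp add: labeled_tree_iff)
  then show "finite ?C"
    using finite_alphabet finite_range_loop_type[OF automaton]
    by (intro finite_cartesian_product finite_PiE finite_boundary) auto
qed

end

section \<open>The class of one element below a parameter as a box\<close>

locale tree_class = tree_order +
  fixes p x0
  assumes x0: "(x0, p) \<in> R"
begin

abbreviation J :: "bool list set"
  where "J \<equiv> boundary (dom p)"

definition X :: "bool list \<Rightarrow> 'a btree set"
  where "X u = pieces (loop_type A (subtree x0 u))"

text \<open>
  The class of \<open>x0\<close> is the image under \<open>plug\<close> of the box of all choices of subtrees at the
  boundary of \<open>dom p\<close> which have the same types as the subtrees of \<open>x0\<close>.
\<close>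

definition plug :: "(bool list \<Rightarrow> 'a btree) \<Rightarrow> 'a btree"
  where "plug f v = (if v \<in> dom p then x0 v
    else let u = (THE u. u \<in> J \<and> (\<exists>w. v = u @ w)) in f u (drop (length u) v))"

lemma p_tree: "p \<in> P" "finite (dom p)" "[] \<in> dom p" "\<forall>u v. u @ v \<in> dom p \<longrightarrow> u \<in> dom p"
  "prefix_closed p"
proof -
  show "p \<in> P" using le_carrier[OF x0] by blast
  then have "labeled_tree \<Sigma> p" by (rule labeled)
  then show "finite (dom p)" "[] \<in> dom p" "prefix_closed p" by (simp_all add: labeled_tree_iff)
  then show "\<forall>u v. u @ v \<in> dom p \<longrightarrow> u \<in> dom p" by (simp add: prefix_closed_def)
qed

lemma x0_tree: "x0 \<in> P" "finite (dom x0)" "[] \<in> dom x0" "prefix_closed x0" "ran x0 \<subseteq> \<Sigma>"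
  using le_carrier[OF x0] labeled[of x0] by (auto simp: labeled_tree_iff)

lemma plug_inside: "v \<in> dom p \<Longrightarrow> plug f v = x0 v"
  by (simp add: plug_def)

lemma plug_boundary:
  assumes "u \<in> J"
  shows "plug f (u @ w) = f u w"
proof -
  have "u @ w \<notin> dom p" using p_tree(4) assms by (rule boundary_append_notin)
  moreover have "(THE u'. u' \<in> J \<and> (\<exists>w'. u @ w = u' @ w')) = u"
  proof (rule the_equality)
    fix u' assume "u' \<in> J \<and> (\<exists>w'. u @ w = u' @ w')"
    then show "u' = u" using boundary_unique[OF p_tree(4) assms] by metis
  qed (use assms in blast)
  ultimately show ?thesis by (simp add: plug_def)
qed

lemma outside_cases:
  assumes "v \<notin> dom p"
  obtains u w where "u \<in> J" "v = u @ w"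
  using boundary_prefix[OF p_tree(3) assms] by blast

lemma subtree_plug: "u \<in> J \<Longrightarrow> subtree (plug f) u = f u"
  by (simp add: subtree_def plug_boundary)

lemma subtree_p: "u \<in> J \<Longrightarrow> subtree p u = Map.empty"
  using boundary_append_notin[OF p_tree(4)] by (auto simp: subtree_def domIff)

lemma pieceD:
  assumes "f \<in> PiE J X" "u \<in> J"
  shows "finite (dom (f u))" "prefix_closed (f u)" "ran (f u) \<subseteq> \<Sigma>"
    "loop_type A (f u) = loop_type A (subtree x0 u)"
  using PiE_mem[OF assms] by (simp_all add: X_def pieces_def)

lemma labeled_tree_plug:
  assumes f: "f \<in> PiE J X"
  shows "labeled_tree \<Sigma> (plug f)"
  unfolding labeled_tree_iff
proof (intro conjI)
  have "dom (plug f) \<subseteq> dom p \<union> (\<Union>u\<in>J. (@) u ` dom (f u))"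
  proof
    fix v assume v: "v \<in> dom (plug f)"
    show "v \<in> dom p \<union> (\<Union>u\<in>J. (@) u ` dom (f u))"
    proof (cases "v \<in> dom p")
      case False
      then obtain u w where u: "u \<in> J" "v = u @ w" by (rule outside_cases)
      then have "w \<in> dom (f u)" using v plug_boundary[OF u(1)] by (simp add: domIff)
      with u show ?thesis by blast
    qed simp
  qed
  moreover have "finite (dom p \<union> (\<Union>u\<in>J. (@) u ` dom (f u)))"
    using p_tree(2) finite_boundary[OF p_tree(2)] pieceD(1)[OF f] by simp
  ultimately show "finite (dom (plug f))" by (rule finite_subset)
  show "[] \<in> dom (plug f)" using x0_tree(3) plug_inside[OF p_tree(3)] by (simp add: domIff)
  \<comment> \<open>A nonempty piece has a root, and equality of loop types then puts
    \<open>u\<close> into \<open>dom x0\<close>, together with all its prefixes. This is what makes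
    the plugged tree prefix-closed across the boundary.\<close>
  have x0_boundary: "v \<in> dom x0" if "u \<in> J" "f u w \<noteq> None" "u = v @ v'" "v' \<noteq> []" for u v v' w
  proof -
    have "f u [] \<noteq> None"
      using that(2) prefix_closedD[OF pieceD(2)[OF f that(1)], of "[]" w] by (metis append_Nil)
    then have "x0 (u @ []) \<noteq> None"
      using loop_type_root[OF pieceD(4)[OF f that(1)]] by (simp add: subtree_def)
    then show ?thesis using that(3) x0_tree(4) unfolding prefix_closed_def by auto
  qed
  show "prefix_closed (plug f)"
    unfolding prefix_closed_def
  proof (intro allI impI)
    fix u v assume uv: "u @ v \<in> dom (plug f)"
    show "u \<in> dom (plug f)"
    proof (cases "u @ v \<in> dom p")
      case True
      then have "u \<in> dom p" using p_tree(4) by blast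
      moreover have "u @ v \<in> dom x0" using uv plug_inside[OF True] by (simp add: domIff)
      ultimately show ?thesis
        using x0_tree(4) plug_inside[of u] unfolding prefix_closed_def by (simp add: domIff) blast
    next
      case False
      then obtain b w where b: "b \<in> J" "u @ v = b @ w" by (rule outside_cases)
      have fb: "f b w \<noteq> None" using uv b plug_boundary[OF b(1)] by (simp add: domIff)
      from b(2) obtain x where "u = b @ x \<and> x @ v = w \<or> u @ x = b \<and> v = x @ w"
        by (auto simp: append_eq_append_conv2)
      then consider "u = b @ x" "w = x @ v" | "b = u @ x" "x \<noteq> []" by (cases "x = []") auto
      then show ?thesis
      proof cases
        case 1
        then have "f b x \<noteq> None" using fb prefix_closedD[OF pieceD(2)[OF f b(1)], of x v] by metis
        with 1 show ?thesis using plug_boundary[OF b(1)] by (simp add: domIff)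
      next
        case 2
        then have "u \<in> dom p" using boundary_proper_prefix[of "dom p" u x] p_tree(4) b(1) by blast
        then show ?thesis
          using x0_boundary[OF b(1) fb 2] plug_inside[of u] by (simp add: domIff)
      qed
    qed
  qed
  show "ran (plug f) \<subseteq> \<Sigma>"
  proof
    fix a assume "a \<in> ran (plug f)"
    then obtain v where v: "plug f v = Some a" by (auto simp: ran_def)
    show "a \<in> \<Sigma>"
    proof (cases "v \<in> dom p")
      case True
      then have "a \<in> ran x0" using v by (auto simp: plug_inside ran_def)
      then show ?thesis using x0_tree(5) by blast
    next
      case False
      then obtain u w where u: "u \<in> J" "v = u @ w" by (rule outside_cases)
      then have "a \<in> ran (f u)" using v plug_boundary[OF u(1)] by (auto simp: ran_def)
      then show ?thesis using pieceD(3)[OF f u(1)] by blast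
    qed
  qed
qed

lemma reach_outside:
  assumes "prefix_closed x" "prefix_closed y" "prefix_closed x'" "prefix_closed y'"
    and "\<And>v. v \<in> dom p \<Longrightarrow> x v = x' v" "\<And>v. v \<in> dom p \<Longrightarrow> y v = y' v"
    and "\<And>u. u \<in> J \<Longrightarrow> reach A (convolution [subtree x u, subtree y u]) =
      reach A (convolution [subtree x' u, subtree y' u])"
  shows "reach A (convolution [x, y]) = reach A (convolution [x', y'])"
  using p_tree(2,3)
proof (rule reach_cong)
  show "prefix_closed (convolution [x, y])" "prefix_closed (convolution [x', y'])"
    using assms(1-4) by (simp_all add: prefix_closed_convolution)
  show "convolution [x, y] u = convolution [x', y'] u" if "u \<in> dom p" for u
    using assms(5,6)[OF that] by (simp add: convolution_pair)
  show "reach A (subtree (convolution [x, y]) u) = reach A (subtree (convolution [x', y']) u)"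
    if "u \<in> J" for u
    using assms(7)[OF that] by (simp add: subtree_convolution)
qed

lemma prefix_closed_plug: "f \<in> PiE J X \<Longrightarrow> prefix_closed (plug f)"
  using labeled_tree_plug by (simp add: labeled_tree_iff)

text \<open>Beyond the boundary \<open>p\<close> is empty, and the second component of
  \<open>loop_type\<close> fixes the type of a piece against the empty tree. So
  \<open>plug f\<close> looks to the automaton like \<open>x0\<close> when paired with
  \<open>p\<close>.\<close>

lemma plug_below:
  assumes f: "f \<in> PiE J X"
  shows "(plug f, p) \<in> R"
proof (rule le_types)
  show "labeled_tree \<Sigma> (plug f)" using f by (rule labeled_tree_plug)
  show "labeled_tree \<Sigma> p" using p_tree(1) by (rule labeled)
  show "reach A (convolution [plug f, p]) = reach A (convolution [x0, p])"
  proof (rule reach_outside)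
    fix u assume u: "u \<in> J"
    show "reach A (convolution [subtree (plug f) u, subtree p u]) =
        reach A (convolution [subtree x0 u, subtree p u])"
      using pieceD(4)[OF f u] u by (simp add: subtree_plug subtree_p loop_type_def pair_type_def)
  qed (use f p_tree x0_tree in \<open>simp_all add: prefix_closed_plug plug_inside\<close>)
qed (rule x0)

lemma plug_inject:
  assumes "f \<in> PiE J X" "g \<in> PiE J X" "plug f = plug g"
  shows "f = g"
  using assms(1,2) by (rule PiE_ext) (use assms(3) subtree_plug in metis)

definition box_rel :: "(bool list \<Rightarrow> 'a btree) rel"
  where "box_rel = {(f, g). f \<in> PiE J X \<and> g \<in> PiE J X \<and> (plug f, plug g) \<in> L}"

lemma plug_types:
  assumes "f \<in> PiE J X" "g \<in> PiE J X" "f' \<in> PiE J X" "g' \<in> PiE J X"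
    and "\<And>u. u \<in> J \<Longrightarrow> pair_type A (f u) (g u) = pair_type A (f' u) (g' u)"
  shows "pair_type A (plug f) (plug g) = pair_type A (plug f') (plug g')"
proof -
  have "reach A (convolution [plug f, plug g]) = reach A (convolution [plug f', plug g'])"
    by (rule reach_outside) (use assms in \<open>simp_all add: prefix_closed_plug plug_inside subtree_plug pair_type_def\<close>)
  moreover have "reach A (convolution [plug g, plug f]) = reach A (convolution [plug g', plug f'])"
    by (rule reach_outside) (use assms in \<open>simp_all add: prefix_closed_plug plug_inside subtree_plug pair_type_def\<close>)
  ultimately show ?thesis by (simp add: pair_type_def)
qed

sublocale box J X box_rel "pair_type A"
proof
  show "finite J" using p_tree(2) by (rule finite_boundary)
  show "finite (range (case_prod (pair_type A)))" using automaton by (rule finite_range_pair_type)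
  show "pair_type A a a = pair_type A b b" if "u \<in> J" "a \<in> X u" "b \<in> X u" for u a b
    using that by (auto simp: X_def pieces_def loop_type_def)
  show "pair_type A b a = pair_type A d c" if "pair_type A a b = pair_type A c d" for a b c d
    using that by (simp add: pair_type_def)
  show "box_rel \<subseteq> PiE J X \<times> PiE J X" by (auto simp: box_rel_def)
  show "(x', y') \<in> box_rel"
    if xy: "(x, y) \<in> box_rel" and Z: "x' \<in> PiE J X" "y' \<in> PiE J X"
      and T: "\<And>u. u \<in> J \<Longrightarrow> pair_type A (x' u) (y' u) = pair_type A (x u) (y u)" for x y x' y'
  proof -
    have Z': "x \<in> PiE J X" "y \<in> PiE J X" and L: "(plug x, plug y) \<in> L"
      using xy by (auto simp: box_rel_def)
    have types: "pair_type A (plug x') (plug y') = pair_type A (plug x) (plug y)"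
      using Z Z' T by (rule plug_types)
    have R: "(plug f, plug g) \<in> R \<longleftrightarrow> reach A (convolution [plug f, plug g]) \<inter> Some ` accepting A \<noteq> {}"
      if "f \<in> PiE J X" "g \<in> PiE J X" for f g
      using R_iff convolution_in_language_iff[OF automaton] that[THEN labeled_tree_plug] by metis
    have P: "plug f \<in> P" if "f \<in> PiE J X" for f using plug_below[OF that] le_carrier by blast
    have "(plug x', plug y') \<in> L"
      using L types R Z Z' unfolding L_iff[OF P[OF Z(1)]] L_iff[OF P[OF Z'(1)]] by (simp add: pair_type_def)
    then show ?thesis using Z by (simp add: box_rel_def)
  qed
  show "trans box_rel" using trans_L unfolding box_rel_def trans_def by blast
  show "irrefl box_rel" by (auto simp: box_rel_def irrefl_def)
  show "y = z \<or> (y, z) \<in> box_rel \<or> (z, y) \<in> box_rel" if "(x, y) \<in> box_rel" "(x, z) \<in> box_rel" for x y z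
    using that L_upward[of "plug x" "plug y" "plug z"] plug_inject[of y z] by (auto simp: box_rel_def)
qed

text \<open>Cutting a member of the class at the boundary gives an element of the box, and
  \<open>plug\<close> reassembles it; so the class embeds into the box.\<close>

lemma rank_below_class:
  assumes "rank_below box_rel Z w"
  shows "rank_below L {x. (x, p) \<in> R \<and> class_of p x = class_of p x0} w"
  using assms order_refl
proof (rule rank_below_map[where g = "\<lambda>x. \<lambda>u\<in>J. subtree x u"])
  let ?C = "{x. (x, p) \<in> R \<and> class_of p x = class_of p x0}" and ?g = "\<lambda>x. \<lambda>u\<in>J. subtree x u"
  have gZ: "?g x \<in> Z" if "x \<in> ?C" for x
    unfolding restrict_PiE_iff
  proof
    fix u assume u: "u \<in> J"
    have x: "finite (dom x)" "prefix_closed x" "ran x \<subseteq> \<Sigma>"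
      using that labeled[of x] le_carrier by (auto simp: labeled_tree_iff)
    have "(\<lambda>u\<in>J. loop_type A (subtree x u)) = (\<lambda>u\<in>J. loop_type A (subtree x0 u))"
      using that by (simp add: class_of_def)
    from fun_cong[OF this, of u] u have "loop_type A (subtree x u) = loop_type A (subtree x0 u)" by simp
    moreover have "finite (dom (subtree x u))"
    proof -
      have "(@) u ` dom (subtree x u) \<subseteq> dom x" by (auto simp: subtree_def)
      then have "finite ((@) u ` dom (subtree x u))" using x(1) by (rule finite_subset)
      then show ?thesis by (rule finite_imageD) (simp add: inj_on_def)
    qed
    moreover have "ran (subtree x u) \<subseteq> \<Sigma>" using x(3) by (auto simp: subtree_def ran_def)
    ultimately show "subtree x u \<in> X u"
      using prefix_closed_subtree[OF x(2)] by (simp add: X_def pieces_def)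
  qed
  then show "?g ` ?C \<subseteq> Z" by blast
  have plug: "plug (?g x) = x" if "x \<in> ?C" for x
  proof
    fix v show "plug (?g x) v = x v"
    proof (cases "v \<in> dom p")
      case True
      have "restrict x (dom p) = restrict x0 (dom p)" using that by (simp add: class_of_def)
      from fun_cong[OF this, of v] True show ?thesis by (simp add: plug_inside)
    next
      case False
      then obtain u w where "u \<in> J" "v = u @ w" by (rule outside_cases)
      then show ?thesis by (simp add: plug_boundary subtree_def)
    qed
  qed
  fix x y assume "x \<in> ?C" "y \<in> ?C" "(x, y) \<in> L"
  then show "(?g x, ?g y) \<in> box_rel" using gZ plug by (simp add: box_rel_def)
qed

lemma rank_below_box:
  assumes "rank_below L {x. (x, p) \<in> R} w"
  shows "rank_below box_rel Z w"
  using assms order_refl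
  by (rule rank_below_map[where g = plug]) (auto simp: box_rel_def plug_below)

lemma fibre_eq: "fibre u = piece_rel (fibre_types u)"
  by (simp add: fibre_def piece_rel_def)

text \<open>Any bound for the ideal of \<open>p\<close>, however large, bounds the fibres embedded
  in it, and \<open>uniform\<close> exchanges it for a bound that does not depend on
  \<open>p\<close>.\<close>

lemma rank_below_singleton:
  fixes e :: "'e::{wellorder,ordered_cancel_comm_monoid_add}"
  assumes uniform: "\<And>q \<Theta> w. rank_below (piece_rel \<Theta>) (pieces q) (w :: 'e multiset) \<Longrightarrow>
      rank_below (piece_rel \<Theta>) (pieces q) {#e#}"
    and "rank_below L {x. (x, p) \<in> R} (w :: 'e multiset)" "u \<in> J"
  shows "rank_below (U {u}) Z {#e#}"
proof (cases "Z = {}")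
  case True
  then show ?thesis by (simp add: rank_below_empty)
next
  case False
  then obtain z where "z \<in> Z" by blast
  have "rank_below (fibre u) (X u) w"
    using rank_below_box[OF assms(2)] \<open>z \<in> Z\<close> assms(3) by (rule rank_below_fibre)
  then have "rank_below (fibre u) (X u) {#e#}"
    unfolding fibre_eq X_def by (rule uniform)
  then show ?thesis using assms(3) by (rule rank_below_U_singleton)
qed

end

section \<open>Uniform bounds\<close>

lemma multiset_less_single:
  fixes w :: "'e::{linorder,no_top} multiset"
  shows "\<exists>e. w < {#e#}"
proof -
  \<comment> \<open>Inserting \<open>undefined\<close> keeps \<open>Max\<close> meaningful when
    \<open>w\<close> is empty.\<close>
  obtain e where "Max (insert undefined (set_mset w)) < e" using gt_ex by blast
  then have "\<forall>x\<in>#w. x < e" by (meson Max_ge finite_insert finite_set_mset insertI2 le_less_trans)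
  then show ?thesis by auto
qed

text \<open>The multisets below \<open>{#E#}\<close> are closed under finite sums, as powers of
  omega are closed under natural sums.\<close>

lemma rank_below_finite_classes:
  fixes E :: "'e::wellorder"
  assumes "trans R" "finite (c ` A)"
    and "\<And>x0. x0 \<in> A \<Longrightarrow> \<exists>w<{#E#}. rank_below R {x \<in> A. c x = c x0} w"
  shows "\<exists>w<{#E#}. rank_below R A w"
proof -
  have "\<forall>q\<in>c ` A. \<exists>w. w < {#E#} \<and> rank_below R {x \<in> A. c x = q} w" using assms(3) by blast
  from bchoice[OF this] obtain w
    where w: "\<forall>q\<in>c ` A. w q < {#E#} \<and> rank_below R {x \<in> A. c x = q} (w q)" by blast
  have "rank_below R (\<Union>q\<in>c ` A. {x \<in> A. c x = q}) (sum w (c ` A))"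
    using assms(1,2) by (rule rank_below_UN) (use w in blast)
  moreover have "(\<Union>q\<in>c ` A. {x \<in> A. c x = q}) = A" by blast
  moreover have "sum w (c ` A) < {#E#}"
    using w assms(2) by (auto simp: set_mset_sum)
  ultimately show ?thesis by metis
qed

text \<open>
  Ranks grow without jumps, so they cannot reach \<open>{#E#}\<close> if every principal ideal whose rank is
  represented at all has a rank below \<open>{#E#}\<close>.
\<close>

lemma rank_below_gap:
  fixes E :: "'e::wellorder"
  assumes "wf S" "trans S"
    and gap: "\<And>p w. p \<in> F \<Longrightarrow> rank_below S {x \<in> F. x = p \<or> (x, p) \<in> S} (w :: 'e multiset) \<Longrightarrow>
      \<exists>w<{#E#}. rank_below S {x \<in> F. x = p \<or> (x, p) \<in> S} w"
  shows "rank_below S F {#E#}"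
proof -
  have "\<exists>w<{#E#}. rank_below S {x \<in> F. x = p \<or> (x, p) \<in> S} w" if "p \<in> F" for p
    using assms(1) that
  proof (induction p rule: wf_induct_rule)
    case (less p)
    have "rank_below S {x \<in> F. (x, p) \<in> S} {#E#}"
    proof (rule rank_below_step[OF \<open>trans S\<close>])
      fix y assume y: "y \<in> {x \<in> F. (x, p) \<in> S}"
      then obtain w where w: "w < {#E#}" "rank_below S {x \<in> F. x = y \<or> (x, y) \<in> S} w"
        using less.IH by blast
      have "rank_below S {z \<in> {x \<in> F. (x, p) \<in> S}. (z, y) \<in> S} w"
        using w(2) by (rule rank_below_mono) auto
      with w(1) show "\<exists>w'<{#E#}. rank_below S {z \<in> {x \<in> F. (x, p) \<in> S}. (z, y) \<in> S} w'" by blast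
    qed
    moreover have "rank_below S {p} {#E#}"
      unfolding rank_below_def
      using wf_not_refl[OF assms(1), of p] by (intro exI[of _ "\<lambda>_. {#}"]) simp
    \<comment> \<open>Adding \<open>p\<close> itself overshoots the target, but \<open>gap\<close>
      accepts any bound and returns one below \<open>{#E#}\<close>.\<close>
    ultimately have "rank_below S ({x \<in> F. (x, p) \<in> S} \<union> {p}) ({#E#} + {#E#})"
      using \<open>trans S\<close> by (intro rank_below_Un)
    then have "rank_below S {x \<in> F. x = p \<or> (x, p) \<in> S} ({#E#} + {#E#})"
      by (rule rank_below_mono) auto
    then show ?case by (rule gap[OF less.prems])
  qed
  note low = this
  show ?thesis
  proof (rule rank_below_step[OF \<open>trans S\<close>])
    fix y assume "y \<in> F"
    from low[OF this] obtain w where w: "w < {#E#}" "rank_below S {x \<in> F. x = y \<or> (x, y) \<in> S} w" by blast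
    have "rank_below S {z \<in> F. (z, y) \<in> S} w"
      using w(2) by (rule rank_below_mono) auto
    with w(1) show "\<exists>w'<{#E#}. rank_below S {z \<in> F. (z, y) \<in> S} w'" by blast
  qed
qed

context tree_order
begin

text \<open>
  Only finitely many relations \<open>piece_rel \<Theta>\<close> on sets \<open>pieces q\<close> exist, for all parameters together.
\<close>

lemma uniform_exponent:
  obtains e :: "'e::{wellorder,no_top}" where "\<And>q \<Theta> w. rank_below (piece_rel \<Theta>) (pieces q) (w :: 'e multiset) \<Longrightarrow>
    rank_below (piece_rel \<Theta>) (pieces q) {#e#}"
proof -
  let ?S = "range (loop_type A) \<times> Pow (range (case_prod (pair_type A)))"
  let ?Q = "\<lambda>s (w :: 'e multiset). rank_below (piece_rel (snd s)) (pieces (fst s)) w"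
  have "\<forall>s\<in>?S. \<exists>e. \<forall>w. ?Q s w \<longrightarrow> ?Q s {#e#}"
  proof
    fix s
    show "\<exists>e. \<forall>w. ?Q s w \<longrightarrow> ?Q s {#e#}"
    proof (cases "\<exists>w. ?Q s w")
      case True
      then obtain w where w: "?Q s w" by blast
      obtain e where "w < {#e#}" using multiset_less_single by blast
      then have "?Q s {#e#}" using rank_below_mono[OF w subset_refl] by simp
      then show ?thesis by blast
    qed blast
  qed
  from bchoice[OF this] obtain e where e: "\<And>s w. s \<in> ?S \<Longrightarrow> ?Q s w \<Longrightarrow> ?Q s {#e s#}" by blast
  let ?e = "Max (insert undefined (e ` ?S))"
  have fin: "finite ?S"
    using finite_range_loop_type[OF automaton] finite_range_pair_type[OF automaton] by simp
  show thesis
  proof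
    fix q \<Theta> and w :: "'e multiset"
    assume w: "rank_below (piece_rel \<Theta>) (pieces q) w"
    show "rank_below (piece_rel \<Theta>) (pieces q) {#?e#}"
    proof (cases "q \<in> range (loop_type A)")
      case True
      \<comment> \<open>An arbitrary \<open>\<Theta>\<close> may contain pairs that are no types of
        trees. Intersecting with the types that occur leaves \<open>piece_rel\<close> unchanged and
        lands in the finite set \<open>?S\<close>.\<close>
      let ?s = "(q, \<Theta> \<inter> range (case_prod (pair_type A)))"
      have eq: "piece_rel \<Theta> = piece_rel (snd ?s)"
        by (auto simp: piece_rel_def intro: range_eqI[of _ _ "(s, t)" for s t])
      have s: "?s \<in> ?S" using True by auto
      then have "e ?s \<le> ?e" using fin by (intro Max_ge) auto
      then have le: "{#e ?s#} \<le> {#?e#}" by (simp only: mset_le_single_iff)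
      have "?Q ?s {#e ?s#}" using s by (rule e) (use w eq in simp)
      from rank_below_mono[OF this subset_refl le] eq show ?thesis by simp
    next
      case False
      then have "pieces q = {}" by (auto simp: pieces_def)
      then show ?thesis by (simp add: rank_below_empty)
    qed
  qed
qed

lemma down_set_eq: "p \<in> P \<Longrightarrow> {x \<in> P. x = p \<or> (x, p) \<in> L} = {x. (x, p) \<in> R}"
  using le_carrier R_refl by auto

lemma rank_below_gap_classes:
  fixes E :: "'e::wellorder"
  assumes "wf L"
    and "\<And>p x0 w. (x0, p) \<in> R \<Longrightarrow> rank_below L {x. (x, p) \<in> R} (w :: 'e multiset) \<Longrightarrow>
      \<exists>w<{#E#}. rank_below L {x. (x, p) \<in> R \<and> class_of p x = class_of p x0} w"
  shows "rank_below L P {#E#}"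
proof (rule rank_below_gap[OF assms(1) trans_L])
  fix p and w :: "'e multiset"
  assume "p \<in> P" and w: "rank_below L {x \<in> P. x = p \<or> (x, p) \<in> L} w"
  show "\<exists>w<{#E#}. rank_below L {x \<in> P. x = p \<or> (x, p) \<in> L} w"
    unfolding down_set_eq[OF \<open>p \<in> P\<close>]
  proof (rule rank_below_finite_classes[OF trans_L finite_class_of[OF \<open>p \<in> P\<close>]])
    fix x0 assume "x0 \<in> {x. (x, p) \<in> R}"
    then show "\<exists>w<{#E#}. rank_below L {x \<in> {x. (x, p) \<in> R}. class_of p x = class_of p x0} w"
      using assms(2)[of x0 p w] w down_set_eq[OF \<open>p \<in> P\<close>] by simp
  qed
qed

section \<open>The two bounds, with ranks represented by multisets\<close>

text \<open>The exponent of a box is a sum of copies of \<open>{#k#}\<close>, one for each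
  coordinate. Their number varies with \<open>p\<close>, but every such sum stays below
  \<open>{#Suc k#}\<close>.\<close>

lemma rank_below_upwards_linear:
  assumes "wf L"
  shows "\<exists>k. rank_below L P {#{#k::nat#}#}"
proof -
  obtain e :: "nat multiset" where e: "\<And>q \<Theta> w. rank_below (piece_rel \<Theta>) (pieces q) (w :: nat multiset multiset) \<Longrightarrow>
    rank_below (piece_rel \<Theta>) (pieces q) {#e#}" by (rule uniform_exponent) blast
  obtain k where "e < {#k#}" using multiset_less_single by blast
  have uniform: "rank_below (piece_rel \<Theta>) (pieces q) {#{#k#}#}"
    if "rank_below (piece_rel \<Theta>) (pieces q) w" for q \<Theta> and w :: "nat multiset multiset"
    using e[OF that] subset_refl by (rule rank_below_mono) (use \<open>e < {#k#}\<close> in simp)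
  have "rank_below L P {#{#Suc k#}#}"
  proof (rule rank_below_gap_classes[OF assms])
    fix p x0 and w :: "nat multiset multiset"
    assume "(x0, p) \<in> R" and w: "rank_below L {x. (x, p) \<in> R} w"
    interpret tree_class A \<Sigma> P R p x0 by unfold_locales fact
    have "rank_below (U {u}) Z {#{#k#}#}" if "u \<in> J" for u
      using uniform w that by (rule rank_below_singleton)
    from rank_below_fibres[OF this] obtain n
      where "rank_below box_rel Z (replicate_mset n (\<Sum>u\<in>J. {#k#}))" by blast
    from rank_below_class[OF this] show
      "\<exists>w<{#{#Suc k#}#}. rank_below L {x. (x, p) \<in> R \<and> class_of p x = class_of p x0} w"
      by (intro exI[of _ "replicate_mset n (\<Sum>u\<in>J. {#k#})"])
        (auto simp: set_mset_sum finite_J split: if_splits)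
  qed
  then show ?thesis by blast
qed

text \<open>The exponent of a box is \<open>k + 2\<close> for any number of coordinates; one more
  absorbs the finite factor \<open>n\<close>.\<close>

lemma rank_below_forest_order:
  assumes "wf L" and finite_up: "\<And>x. finite {y. (x, y) \<in> L}"
  shows "\<exists>k. rank_below L P {#k::nat#}"
proof -
  obtain k :: nat where uniform: "\<And>q \<Theta> w. rank_below (piece_rel \<Theta>) (pieces q) (w :: nat multiset) \<Longrightarrow>
    rank_below (piece_rel \<Theta>) (pieces q) {#k#}" by (rule uniform_exponent) blast
  have "rank_below L P {#k + 3#}"
  proof (rule rank_below_gap_classes[OF assms(1)])
    fix p x0 and w :: "nat multiset"
    assume "(x0, p) \<in> R" and w: "rank_below L {x. (x, p) \<in> R} w"
    interpret tree_class A \<Sigma> P R p x0 by unfold_locales fact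
    interpret forest_box J X box_rel "pair_type A"
    proof
      fix x
      have "plug ` {y. (x, y) \<in> box_rel} \<subseteq> {y. (plug x, y) \<in> L}" by (auto simp: box_rel_def)
      then have "finite (plug ` {y. (x, y) \<in> box_rel})" using finite_up by (rule finite_subset)
      moreover have "inj_on plug {y. (x, y) \<in> box_rel}"
        by (auto simp: inj_on_def box_rel_def intro: plug_inject)
      ultimately show "finite {y. (x, y) \<in> box_rel}" by (rule finite_imageD)
    qed
    have "rank_below (U {u}) Z {#k#}" if "u \<in> J" for u
      using uniform w that by (rule rank_below_singleton)
    from rank_below_forest[OF this] obtain n
      where "rank_below box_rel Z (replicate_mset n (k + 2))" by blast
    from rank_below_class[OF this] show
      "\<exists>w<{#k + 3#}. rank_below L {x. (x, p) \<in> R \<and> class_of p x = class_of p x0} w"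
      by (intro exI[of _ "replicate_mset n (k + 2)"]) (auto split: if_splits)
  qed
  then show ?thesis by blast
qed

end

section \<open>Comparison with the countable ordinals\<close>

lemma cord_cases:
  obtains "b = ozero" | c where "b = osucc c" | "b \<noteq> ozero" "\<And>c. b \<noteq> osucc c"
  by blast

text \<open>With \<open>c\<close> also \<open>osucc c\<close> lies below the limit \<open>b\<close>,
  so the left side is among the values whose supremum is taken.\<close>

lemma otrec_limit_upper:
  assumes "b \<noteq> ozero" "\<And>c. b \<noteq> osucc c" "c < b"
  shows "s (otrec z s c) \<le> otrec z s b"
proof -
  have "osucc c < b" using assms(2)[of c] assms(3) osucc_le_iff[of c b] by (auto simp: le_less)
  moreover have "ozero < osucc c" using ozero_le less_osucc by (rule le_less_trans)
  ultimately have "otrec z s (osucc c) \<in> otrec z s ` {ozero<..<b}" by simp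
  moreover have "countable {ozero<..<b}"
    by (rule countable_subset[OF _ countable_lessThan_cord[of b]]) auto
  then have "countable (otrec z s ` {ozero<..<b})" by simp
  from osup_le_iff[OF this, of "otrec z s b"]
  have "\<forall>x\<in>otrec z s ` {ozero<..<b}. x \<le> otrec z s b"
    using otrec_limit[OF assms(1,2), of z s] by simp
  ultimately have "otrec z s (osucc c) \<le> otrec z s b" by blast
  then show ?thesis by (simp add: otrec_succ)
qed

lemma otrec_mono:
  assumes s: "\<And>x. x \<le> s x" and "b \<le> c"
  shows "otrec z s b \<le> otrec z s c"
  using assms(2)
proof (induction c rule: less_induct)
  case (less c)
  show ?case
  proof (cases "b = c")
    case False
    with less.prems have "b < c" by simp
    show ?thesis
    proof (cases c rule: cord_cases)
      case 1
      with \<open>b < c\<close> ozero_le[of b] show ?thesis by simp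
    next
      case (2 d)
      have "b \<le> d" using \<open>b < c\<close> osucc_le_iff[of d b] unfolding 2 by (meson not_le)
      then have "otrec z s b \<le> otrec z s d" using less.IH[of d] 2 less_osucc by simp
      also have "\<dots> \<le> s (otrec z s d)" by (rule s)
      finally show ?thesis by (simp add: 2 otrec_succ)
    next
      case 3
      have "otrec z s b \<le> s (otrec z s b)" by (rule s)
      also have "\<dots> \<le> otrec z s c" using 3 \<open>b < c\<close> by (rule otrec_limit_upper)
      finally show ?thesis .
    qed
  qed simp
qed

lemma otrec_strict_mono:
  assumes s: "\<And>x. x < s x" and "b < c"
  shows "otrec z s b < otrec z s c"
proof -
  have "otrec z s b < otrec z s (osucc b)" by (simp add: otrec_succ s)
  also have "\<dots> \<le> otrec z s c"
    using s assms(2) by (intro otrec_mono) (auto simp: osucc_le_iff less_imp_le)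
  finally show ?thesis .
qed

lemma strict_mono_self_le:
  fixes f :: "'w::wellorder \<Rightarrow> 'w"
  assumes "\<And>x y. x < y \<Longrightarrow> f x < f y"
  shows "x \<le> f x"
proof (induction x rule: less_induct)
  case (less x)
  show ?case
  proof (rule ccontr)
    assume "\<not> x \<le> f x"
    then have "f x < x" by simp
    with less[of "f x"] assms[of "f x" x] show False by simp
  qed
qed

lemma oadd_strict_mono: "b < c \<Longrightarrow> oadd a b < oadd a c"
  unfolding oadd_def by (intro otrec_strict_mono less_osucc)

lemma oadd_mono: "b \<le> c \<Longrightarrow> oadd a b \<le> oadd a c"
  using oadd_strict_mono[of b c a] by (auto simp: le_less)

lemma oadd_zero: "oadd a ozero = a"
  by (simp add: oadd_def otrec_zero)

lemma le_oadd_left: "a \<le> oadd a b"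
  using oadd_mono[OF ozero_le, of a b] by (simp add: oadd_zero)

lemma le_oadd_right: "b \<le> oadd a b"
  by (rule strict_mono_self_le) (rule oadd_strict_mono)

lemma omult_mono: "b \<le> c \<Longrightarrow> omult a b \<le> omult a c"
  unfolding omult_def by (rule otrec_mono) (rule le_oadd_left)

lemma omult_succ: "omult a (osucc b) = oadd (omult a b) a"
  by (simp add: omult_def otrec_succ)

lemma osucc_funpow_less_omega: "(osucc ^^ n) ozero < omega"
proof -
  have "countable (range (\<lambda>n. (osucc ^^ n) ozero))" by simp
  from osup_le_iff[OF this, of omega] have "(osucc ^^ Suc n) ozero \<le> omega"
    unfolding omega_def by blast
  then show ?thesis by (simp add: osucc_le_iff)
qed

lemma osucc_funpow_strict_mono: "m < n \<Longrightarrow> (osucc ^^ m) ozero < (osucc ^^ n) ozero"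
  by (rule lift_Suc_mono_less) (simp_all add: less_osucc)

lemma osucc_funpow_mono: "m \<le> n \<Longrightarrow> (osucc ^^ m) ozero \<le> (osucc ^^ n) ozero"
  using osucc_funpow_strict_mono[of m n] by (auto simp: le_less)

lemma oexp_succ: "oexp a (osucc b) = omult (oexp a b) a"
  by (simp add: oexp_def otrec_succ)

lemma oexp_omega_mono: "b \<le> c \<Longrightarrow> oexp omega b \<le> oexp omega c"
  unfolding oexp_def
proof (rule otrec_mono)
  fix x
  have "x \<le> oadd (omult x ozero) x" by (rule le_oadd_right)
  also have "\<dots> = omult x (osucc ozero)" by (simp add: omult_succ)
  also have "\<dots> \<le> omult x omega"
    using osucc_funpow_less_omega[of 1] by (intro omult_mono) simp
  finally show "x \<le> omult x omega" .
qed

lemma oexp_omega_pos: "ozero < oexp omega b"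
proof -
  have "osucc ozero \<le> oexp omega b"
    using oexp_omega_mono[OF ozero_le, of b] by (simp add: oexp_def otrec_zero)
  then show ?thesis by (simp add: osucc_le_iff)
qed

lemma elem_rank_le_iff:
  assumes "well_founded r" "countable {q. (q, p) \<in> r - Id}"
  shows "elem_rank r p \<le> b \<longleftrightarrow> (\<forall>q. (q, p) \<in> r - Id \<longrightarrow> elem_rank r q < b)"
proof -
  have "{osucc (elem_rank r q) | q. (q, p) \<in> r - Id} = (\<lambda>q. osucc (elem_rank r q)) ` {q. (q, p) \<in> r - Id}"
    by blast
  then have "countable {osucc (elem_rank r q) | q. (q, p) \<in> r - Id}"
    using assms(2) by simp
  from osup_le_iff[OF this, of b] show ?thesis
    unfolding elem_rank_unfold[OF assms(1), of p] by (auto simp: osucc_le_iff)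
qed

section \<open>Ordinal values of multisets\<close>

text \<open>On a countable wellorder this is the order type of the initial segment below the
  element, which links multisets to \<open>cord\<close>. The relation is reflexive because
  \<open>elem_rank\<close> removes the diagonal.\<close>

definition wrank :: "'w::wellorder \<Rightarrow> cord"
  where "wrank = elem_rank {(x, y). x \<le> y}"

lemma wrank_le_iff:
  assumes "countable (UNIV :: 'w::wellorder set)"
  shows "wrank (x :: 'w) \<le> b \<longleftrightarrow> (\<forall>y<x. wrank y < b)"
proof -
  have eq: "{(x :: 'w, y). x \<le> y} - Id = {(x, y). x < y}" by auto
  then have "well_founded {(x :: 'w, y). x \<le> y}" unfolding well_founded_def by (simp add: wf)
  moreover have "countable {q. (q, x) \<in> {(x :: 'w, y). x \<le> y} - Id}"
    using assms by (rule countable_subset[rotated]) simp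
  ultimately show ?thesis unfolding wrank_def
    by (subst elem_rank_le_iff) (auto simp: less_le)
qed

lemma wrank_strict_mono:
  assumes "countable (UNIV :: 'w::wellorder set)" "x < (y :: 'w)"
  shows "wrank x < wrank y"
  using wrank_le_iff[OF assms(1), of y "wrank y"] assms(2) by simp

lemma countable_multisets:
  assumes "countable (UNIV :: 'a set)"
  shows "countable (UNIV :: 'a multiset set)"
proof -
  have "countable (mset ` lists (UNIV :: 'a set))" by (intro countable_image countable_lists assms)
  moreover have "mset ` lists (UNIV :: 'a set) = UNIV"
    unfolding lists_UNIV surj_def using ex_mset by metis
  ultimately show ?thesis by simp
qed

lemma less_multiset_top:
  fixes M N :: "'w::linorder multiset"
  assumes "M < N" "\<And>x. x \<in># N \<Longrightarrow> x \<le> v"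
  shows "count M v \<le> count N v" "\<And>x. x \<in># M \<Longrightarrow> x \<le> v"
proof -
  have *: "\<exists>z>y. z \<in># N" if less: "count N y < count M y" for y
  proof -
    obtain z where "y < z" "count M z < count N z"
      using assms(1) less unfolding less_multiset\<^sub>H\<^sub>O by blast
    then show ?thesis by (metis count_greater_zero_iff gr_zeroI not_less_zero)
  qed
  show "count M v \<le> count N v" using *[of v] assms(2) by (meson not_le)
  show "x \<le> v" if "x \<in># M" for x
  proof (rule ccontr)
    assume "\<not> x \<le> v"
    then have "x \<notin># N" using assms(2) by blast
    then have "count N x < count M x" using that by (simp add: not_in_iff)
    from *[OF this] assms(2) \<open>\<not> x \<le> v\<close> show False by fastforce
  qed
qed

lemma multiset_split_top:
  fixes N :: "'w::linorder multiset"
  assumes "\<And>x. x \<in># N \<Longrightarrow> x \<le> v"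
  shows "N = replicate_mset (count N v) v + filter_mset (\<lambda>x. x < v) N"
proof (rule multiset_eqI)
  fix x
  show "count N x = count (replicate_mset (count N v) v + filter_mset (\<lambda>x. x < v) N) x"
    using assms[of x] by (cases x v rule: linorder_cases) (auto simp: count_eq_zero_iff)
qed

text \<open>Split off the \<open>n\<close> copies of the maximum \<open>v\<close>. The tail is below
  omega to the \<open>h v\<close> by induction, so the value is below \<open>n + 1\<close> times
  this power, hence at most omega to the \<open>osucc (h v)\<close>.\<close>

lemma wrank_multiset_less:
  fixes h :: "'w::wellorder \<Rightarrow> cord"
  assumes count: "countable (UNIV :: 'w set)" and h: "\<And>x y. x < y \<Longrightarrow> h x < h y"
    and "\<And>x. x \<in># M \<Longrightarrow> x < w"
  shows "wrank M < oexp omega (h w)"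
  using assms(3)
proof (induction w arbitrary: M rule: less_induct)
  case (less w)
  note count' = countable_multisets[OF count]
  show ?case
  proof (cases "M = {#}")
    case True
    then have "wrank M \<le> ozero" by (subst wrank_le_iff[OF count']) simp
    then show ?thesis using oexp_omega_pos by (rule le_less_trans)
  next
    case False
    define v where "v = Max (set_mset M)"
    have v: "v \<in># M" "\<And>x. x \<in># M \<Longrightarrow> x \<le> v" using False by (auto simp: v_def)
    have "v < w" using v(1) less.prems by blast
    let ?c = "oexp omega (h v)" and ?o = "\<lambda>n. (osucc ^^ n) ozero"
      and ?f = "filter_mset (\<lambda>x. x < v)"
    have tail: "wrank (?f N) < ?c" for N using less.IH[OF \<open>v < w\<close>, of "?f N"] by simp
    have next_le: "oadd (omult ?c (?o m)) (wrank (?f N)) < omult ?c (?o (Suc m))" for m N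
      using oadd_strict_mono[OF tail] by (simp add: omult_succ)
    \<comment> \<open>A smaller multiset has either fewer copies of \<open>v\<close>, and then
      \<open>next_le\<close> applies, or equally many and a smaller tail.\<close>
    have bound: "wrank N \<le> oadd (omult ?c (?o (count N v))) (wrank (?f N))"
      if "\<And>x. x \<in># N \<Longrightarrow> x \<le> v" for N
      using that
    proof (induction N rule: less_induct)
      case (less N)
      show ?case
        unfolding wrank_le_iff[OF count', of N]
      proof (intro allI impI)
        fix K assume "K < N"
        note K = less_multiset_top[OF \<open>K < N\<close> less.prems]
        have "wrank K \<le> oadd (omult ?c (?o (count K v))) (wrank (?f K))"
          using \<open>K < N\<close> K(2) by (rule less.IH)
        also have "\<dots> < oadd (omult ?c (?o (count N v))) (wrank (?f N))"
        proof (cases "count K v = count N v")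
          case True
          then have "replicate_mset (count N v) v + ?f K < replicate_mset (count N v) v + ?f N"
            using \<open>K < N\<close> multiset_split_top[OF K(2)] multiset_split_top[OF less.prems] by metis
          then have "?f K < ?f N" by simp
          then have "wrank (?f K) < wrank (?f N)" by (rule wrank_strict_mono[OF count'])
          then show ?thesis unfolding True by (rule oadd_strict_mono)
        next
          case False
          with K(1) have "Suc (count K v) \<le> count N v" by simp
          have "oadd (omult ?c (?o (count K v))) (wrank (?f K)) < omult ?c (?o (Suc (count K v)))"
            by (rule next_le)
          also have "\<dots> \<le> omult ?c (?o (count N v))"
            using \<open>Suc (count K v) \<le> count N v\<close> by (intro omult_mono osucc_funpow_mono)
          also have "\<dots> \<le> oadd (omult ?c (?o (count N v))) (wrank (?f N))"
            by (rule le_oadd_left)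
          finally show ?thesis .
        qed
        finally show "wrank K < oadd (omult ?c (?o (count N v))) (wrank (?f N))" .
      qed
    qed
    have "wrank M \<le> oadd (omult ?c (?o (count M v))) (wrank (?f M))"
      using v(2) by (rule bound)
    also have "\<dots> < omult ?c (?o (Suc (count M v)))" by (rule next_le)
    also have "\<dots> \<le> omult ?c omega"
      using osucc_funpow_less_omega by (intro omult_mono) (rule less_imp_le)
    also have "\<dots> = oexp omega (osucc (h v))" by (simp add: oexp_succ)
    also have "\<dots> \<le> oexp omega (h w)"
      using h[OF \<open>v < w\<close>] by (intro oexp_omega_mono) (simp add: osucc_le_iff)
    finally show ?thesis .
  qed
qed

text \<open>Without a top element every multiset lies below some singleton \<open>{#w#}\<close>, and
  \<open>h w\<close> stays below \<open>b\<close>.\<close>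

lemma wrank_multiset_bound:
  fixes h :: "'w::{wellorder,no_top} \<Rightarrow> cord"
  assumes "countable (UNIV :: 'w set)" "\<And>x y. x < y \<Longrightarrow> h x < h y" "\<And>x. h x < b"
  shows "wrank (M :: 'w multiset) < oexp omega b"
proof -
  obtain w where "M < {#w#}" using multiset_less_single by blast
  then have "wrank M < oexp omega (h w)"
    using assms(1,2) by (intro wrank_multiset_less) auto
  also have "\<dots> \<le> oexp omega b" using assms(3) by (intro oexp_omega_mono less_imp_le)
  finally show ?thesis .
qed

lemma wrank_nat_multiset: "wrank (M :: nat multiset) < oexp omega omega"
  by (rule wrank_multiset_bound[where h = "\<lambda>n. (osucc ^^ n) ozero"])
    (simp_all add: osucc_funpow_strict_mono osucc_funpow_less_omega)

lemma wrank_nat_multiset_multiset: "wrank (M :: nat multiset multiset) < oexp omega (oexp omega omega)"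
proof (rule wrank_multiset_bound[where h = wrank])
  show c: "countable (UNIV :: nat multiset set)" by (rule countable_multisets) simp
  show "wrank x < wrank y" if "x < y" for x y :: "nat multiset"
    using c that by (rule wrank_strict_mono)
qed (rule wrank_nat_multiset)

text \<open>The rank is the least strictly increasing assignment, so it is at most
  \<open>wrank (f x)\<close> at each \<open>x\<close>, and this is below
  \<open>wrank w\<close>.\<close>

lemma order_rank_le:
  fixes w :: "'w::wellorder"
  assumes "countable (UNIV :: 'w set)" "countable P" "r \<subseteq> P \<times> P" "well_founded r"
    and "rank_below (r - Id) P w"
  shows "order_rank P r \<le> wrank w"
proof -
  obtain f where f: "\<forall>x\<in>P. f x < w" "\<forall>x\<in>P. \<forall>y\<in>P. (x, y) \<in> r - Id \<longrightarrow> f x < f y"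
    using assms(5) unfolding rank_below_def by blast
  have wf: "wf (r - Id)" using assms(4) by (simp add: well_founded_def)
  have "elem_rank r x \<le> wrank (f x)" if "x \<in> P" for x
    using wf that
  proof (induction x rule: wf_induct_rule)
    case (less x)
    have "countable {q. (q, x) \<in> r - Id}"
      using assms(3) by (intro countable_subset[OF _ assms(2)]) auto
    moreover have "elem_rank r q < wrank (f x)" if "(q, x) \<in> r - Id" for q
    proof -
      have "q \<in> P" using that assms(3) by blast
      then have "elem_rank r q \<le> wrank (f q)" using less.IH that by blast
      also have "\<dots> < wrank (f x)"
        using f(2) \<open>q \<in> P\<close> less.prems that by (intro wrank_strict_mono[OF assms(1)]) blast
      finally show ?thesis .
    qed
    ultimately show ?case using elem_rank_le_iff[OF assms(4)] by blast
  qed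
  then have "osucc (elem_rank r x) \<le> wrank w" if "x \<in> P" for x
    using that f(1) wrank_strict_mono[OF assms(1), of "f x" w]
    unfolding osucc_le_iff by (meson le_less_trans)
  moreover have "{osucc (elem_rank r p) | p. p \<in> P} = (\<lambda>p. osucc (elem_rank r p)) ` P" by blast
  ultimately show ?thesis
    unfolding order_rank_def using osup_le_iff[of "(\<lambda>p. osucc (elem_rank r p)) ` P"] assms(2) by simp
qed

section \<open>Transfer between the order and its tree presentation\<close>

lemma upwards_linear_comparable:
  assumes "upwards_linear P r" "(x, y) \<in> r - Id" "(x, z) \<in> r - Id"
  shows "(y, z) \<in> r \<or> (z, y) \<in> r"
proof -
  have po: "partial_order_on P r" using assms(1) by (simp add: upwards_linear_def)
  note r = partial_order_onD[OF po]
  have P: "x \<in> P" "y \<in> P" "z \<in> P" using r(4) assms(2,3) by auto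
  then have "linear_order_on (up P r x) (Restr r (up P r x))"
    using assms(1) by (simp add: upwards_linear_def)
  then have "total_on (up P r x) (Restr r (up P r x))" by (simp add: linear_order_on_def)
  moreover have "y \<in> up P r x" "z \<in> up P r x" using assms(2,3) P by (auto simp: up_def)
  ultimately show ?thesis
    using r(1) P by (cases "y = z") (auto simp: total_on_def refl_on_def)
qed

definition pullback :: "'b set \<Rightarrow> ('b \<Rightarrow> 'a) \<Rightarrow> 'a rel \<Rightarrow> 'b rel"
  where "pullback D f r = {(s, t). s \<in> D \<and> t \<in> D \<and> (f s, f t) \<in> r}"

lemma rank_below_pullback:
  assumes "bij_betw f D P" "rank_below (pullback D f r - Id) D w"
  shows "rank_below (r - Id) P w"
  using assms(2) order_refl
proof (rule rank_below_map)
  show sub: "the_inv_into D f ` P \<subseteq> D"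
    using bij_betw_the_inv_into[OF assms(1)] by (simp add: bij_betw_def)
  fix x y assume xy: "x \<in> P" "y \<in> P" "(x, y) \<in> r - Id"
  have "f (the_inv_into D f x) = x" "f (the_inv_into D f y) = y"
    using f_the_inv_into_f_bij_betw[OF assms(1)] xy by simp_all
  moreover have "the_inv_into D f x \<in> D" "the_inv_into D f y \<in> D" using sub xy by auto
  ultimately show "(the_inv_into D f x, the_inv_into D f y) \<in> pullback D f r - Id"
    using xy(3) by (auto simp: pullback_def)
qed

lemma wf_pullback:
  assumes "inj_on f D" "well_founded r"
  shows "wf (pullback D f r - Id)"
proof (rule wf_subset)
  show "wf (inv_image (r - Id) f)" using assms(2) by (simp add: well_founded_def)
  show "pullback D f r - Id \<subseteq> inv_image (r - Id) f"
    using inj_onD[OF assms(1)] by (auto simp: pullback_def inv_image_def)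
qed

lemma finite_up_pullback:
  assumes "bij_betw f D P" "\<And>p. p \<in> P \<Longrightarrow> finite (up P r p)"
  shows "finite {y. (x, y) \<in> pullback D f r - Id}"
proof (cases "x \<in> D")
  case True
  have inj: "inj_on f D" using assms(1) by (rule bij_betw_imp_inj_on)
  have "f ` {y. (x, y) \<in> pullback D f r - Id} \<subseteq> up P r (f x)"
    using inj_onD[OF inj] bij_betwE[OF assms(1)] by (auto simp: pullback_def up_def)
  moreover have "finite (up P r (f x))" using assms(2) bij_betwE[OF assms(1)] True by blast
  ultimately have "finite (f ` {y. (x, y) \<in> pullback D f r - Id})" by (rule finite_subset)
  moreover have "inj_on f {y. (x, y) \<in> pullback D f r - Id}"
    using inj by (rule inj_on_subset) (auto simp: pullback_def)
  ultimately show ?thesis by (rule finite_imageD)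
next
  case False
  then have "{y. (x, y) \<in> pullback D f r - Id} = {}" by (auto simp: pullback_def)
  then show ?thesis by (simp only: finite.emptyI)
qed

text \<open>A convolution of two trees determines both. Hence acceptance of
  \<open>convolution [x, y]\<close>, which only yields some member of \<open>Q\<close> with this
  convolution, means that \<open>[x, y]\<close> itself is in \<open>Q\<close>.\<close>

lemma tree_automatic_orderE:
  assumes "tree_automatic_order P r" "upwards_linear P r"
  obtains A :: "nat option list tree_automaton" and \<Sigma> D f
  where "tree_order A \<Sigma> D (pullback D f r)" "bij_betw f D P"
proof -
  from assms(1) obtain \<Sigma> :: "nat set" and D Ss f where pres: "tree_presentation \<Sigma> D Ss"
    and iso: "structure_iso f D Ss P [{[x, y] | x y. (x, y) \<in> r}]"
    unfolding tree_automatic_order_def tree_automatic_def by blast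
  from iso have bij: "bij_betw f D P" and maps: "[{[x, y] | x y. (x, y) \<in> r}] = map (\<lambda>R. map f ` R) Ss"
    by (simp_all add: structure_iso_def)
  from maps obtain Q where Ss: "Ss = [Q]" and Q: "map f ` Q = {[x, y] | x y. (x, y) \<in> r}"
    by (auto simp: map_eq_Cons_conv)
  from pres Ss obtain A where A: "tree_automaton A" "convolution ` Q = language A"
    by (auto simp: tree_presentation_def regular_def)
  have QD: "set l \<subseteq> D" if "l \<in> Q" for l
    using pres that unfolding Ss tree_presentation_def rel_structure_def by auto
  have inj: "inj_on f D" using bij by (rule bij_betw_imp_inj_on)
  let ?R = "pullback D f r"
  have R_eq: "(s, t) \<in> ?R \<longleftrightarrow> [s, t] \<in> Q" for s t
  proof
    assume "[s, t] \<in> Q"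
    then have "map f [s, t] \<in> {[x, y] | x y. (x, y) \<in> r}" unfolding Q[symmetric] by (rule imageI)
    then have "(f s, f t) \<in> r" by simp
    with QD[OF \<open>[s, t] \<in> Q\<close>] show "(s, t) \<in> ?R" by (simp add: pullback_def)
  next
    assume st: "(s, t) \<in> ?R"
    then have "[f s, f t] \<in> map f ` Q" unfolding Q by (simp add: pullback_def)
    then obtain l where l: "[f s, f t] = map f l" "l \<in> Q" by (rule imageE)
    then obtain s' t' where "l = [s', t']" "f s = f s'" "f t = f t'" by (auto simp: Cons_eq_map_conv)
    with l QD[OF l(2)] st inj show "[s, t] \<in> Q" by (auto simp: pullback_def inj_on_def)
  qed
  have len: "\<exists>s t. l = [s, t]" if "l \<in> Q" for l
  proof -
    have "map f l \<in> {[x, y] | x y. (x, y) \<in> r}" unfolding Q[symmetric] using that by (rule imageI)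
    then show ?thesis by (auto simp: map_eq_Cons_conv)
  qed
  have po: "partial_order_on P r" using assms(2) by (simp add: upwards_linear_def)
  note r = partial_order_onD[OF po]
  have "tree_order A \<Sigma> D ?R"
  proof
    show "tree_automaton A" by (rule A)
    show "finite \<Sigma>" using pres by (simp add: tree_presentation_def)
    show "labeled_tree \<Sigma> x" if "x \<in> D" for x using pres that by (simp add: tree_presentation_def)
    show "(x, y) \<in> ?R \<longleftrightarrow> convolution [x, y] \<in> language A" for x y
    proof
      assume "(x, y) \<in> ?R"
      then show "convolution [x, y] \<in> language A" unfolding R_eq A(2)[symmetric] by (rule imageI)
    next
      assume "convolution [x, y] \<in> language A"
      then obtain l where l: "l \<in> Q" "convolution [x, y] = convolution l"
        unfolding A(2)[symmetric] by blast
      with len[OF l(1)] obtain s t where st: "l = [s, t]" by blast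
      with l convolution_pair_inject[of x y s t] show "(x, y) \<in> ?R" by (simp add: R_eq)
    qed
    show "partial_order_on D ?R"
      unfolding partial_order_on_def preorder_on_def
    proof (intro conjI)
      show "refl_on D ?R" using r(1) bij_betwE[OF bij] by (auto simp: refl_on_def pullback_def)
      show "trans ?R" using transD[OF r(2)] unfolding pullback_def trans_def by blast
      show "antisym ?R"
        using antisymD[OF r(3)] inj_onD[OF inj] unfolding pullback_def antisym_def by blast
      show "?R \<subseteq> D \<times> D" by (auto simp: pullback_def)
    qed
    show "(y, z) \<in> ?R \<or> (z, y) \<in> ?R" if "(x, y) \<in> ?R - Id" "(x, z) \<in> ?R - Id" for x y z
    proof -
      have "(f x, f y) \<in> r - Id" "(f x, f z) \<in> r - Id"
        using that inj_onD[OF inj] by (auto simp: pullback_def)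
      from upwards_linear_comparable[OF assms(2) this] that show ?thesis by (auto simp: pullback_def)
    qed
  qed
  then show thesis using bij by (rule that)
qed

lemma order_rank_le_of_tree_automatic:
  fixes w :: "'w::wellorder"
  assumes "countable (UNIV :: 'w set)" "upwards_linear P r" "well_founded r"
    "tree_automatic_order P r" "rank_below (r - Id) P w"
  shows "order_rank P r \<le> wrank w"
proof (rule order_rank_le)
  show "countable P"
    using assms(4) unfolding tree_automatic_order_def by (rule tree_automatic_countable)
  show "r \<subseteq> P \<times> P"
    using assms(2) unfolding upwards_linear_def by (blast dest: partial_order_onD(4))
qed fact+

theorem theorem3p28:
  fixes P :: "'a set" and r :: "'a rel"
  shows
    "(upwards_linear P r \<and> well_founded r \<and> tree_automatic_order P r \<longrightarrow>
        order_rank P r < oexp omega (oexp omega omega)) \<and>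
     (forest P r \<and> well_founded r \<and> tree_automatic_order P r \<longrightarrow>
        order_rank P r < oexp omega omega)"
proof (intro conjI impI)
  assume "upwards_linear P r \<and> well_founded r \<and> tree_automatic_order P r"
  then have *: "upwards_linear P r" "well_founded r" "tree_automatic_order P r" by simp_all
  obtain A :: "nat option list tree_automaton" and \<Sigma> D f
    where D: "tree_order A \<Sigma> D (pullback D f r)" "bij_betw f D P"
    using *(3,1) by (rule tree_automatic_orderE)
  obtain k where "rank_below (pullback D f r - Id) D {#{#k::nat#}#}"
    using tree_order.rank_below_upwards_linear[OF D(1)
        wf_pullback[OF bij_betw_imp_inj_on[OF D(2)] *(2)]] by blast
  with D(2) have "rank_below (r - Id) P {#{#k#}#}" by (rule rank_below_pullback)
  with * have "order_rank P r \<le> wrank {#{#k#}#}"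
    by (intro order_rank_le_of_tree_automatic countable_multisets) simp_all
  also have "\<dots> < oexp omega (oexp omega omega)" by (rule wrank_nat_multiset_multiset)
  finally show "order_rank P r < oexp omega (oexp omega omega)" .
next
  assume "forest P r \<and> well_founded r \<and> tree_automatic_order P r"
  then have *: "upwards_linear P r" "well_founded r" "tree_automatic_order P r"
    and fin: "\<And>p. p \<in> P \<Longrightarrow> finite (up P r p)" by (simp_all add: forest_def)
  obtain A :: "nat option list tree_automaton" and \<Sigma> D f
    where D: "tree_order A \<Sigma> D (pullback D f r)" "bij_betw f D P"
    using *(3,1) by (rule tree_automatic_orderE)
  obtain k where "rank_below (pullback D f r - Id) D {#k::nat#}"
    using tree_order.rank_below_forest_order[OF D(1)
        wf_pullback[OF bij_betw_imp_inj_on[OF D(2)] *(2)] finite_up_pullback[OF D(2) fin]] by blast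
  with D(2) have "rank_below (r - Id) P {#k#}" by (rule rank_below_pullback)
  with * have "order_rank P r \<le> wrank {#k#}"
    by (intro order_rank_le_of_tree_automatic countable_multisets) simp_all
  also have "\<dots> < oexp omega omega" by (rule wrank_nat_multiset)
  finally show "order_rank P r < oexp omega omega" .
qed

end
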